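(* Let $T=\sum_{k=0}^N Q_k(z)D^k$, with $Q_k\in\mathbb{R}[z]$, be a non-degenerate hyperbolicity preserving differential operator with nonnegative Fuchs index $r$. Suppose that $n\in\mathbb{N}$ is such that $T(z^n)\not\equiv 0$ and that $A\subseteq[n+r]$ is a set of cardinality $r$; put $B=[n+r]\setminus A$. Let $a$ be the smallest zero of $Q_e(z)$, where $e=\min(n,N)$. Define two sequences of polynomials $\{f_i\}_{i=0}^\infty$ and $\{v_i\}_{i=1}^\infty$ recursively by $f_0(z)=(z-a)^n$ and $$T(f_i)=v_{i+1}f_{i+1},$$ where $v_{i+1}f_{i+1}$ is the unique factorization of $T(f_i)$ such that $f_{i+1}$ is monic and the pair $(v_{i+1},f_{i+1})$ has zero pattern $(A,B)$. Then the limits $$\lim_{i\to\infty}f_i=f\quad\text{and}\quad\lim_{i\to\infty}v_i=v$$ exist, $T(f)=vf$, and $(v,f)$ has zero pattern $(A,B)$.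
   Context: $D=d/dz$, $\mathbb{N}=\{0,1,2,\dots\}$, $[m]=\{1,\dots,m\}$. A nonzero polynomial in $\mathbb{R}[z]$ is hyperbolic if all its zeros are real. A linear operator $T:\mathbb{R}[z]\to\mathbb{R}[z]$ preserves hyperbolicity if $T(f)$ is hyperbolic or identically zero whenever $f$ is hyperbolic. The Fuchs index of $T=\sum_{k=0}^N Q_kD^k$ (with $Q_N\not\equiv0$) is $r=\max_k(\deg Q_k-k)$, the maximum being over $k$ with $Q_k\not\equiv 0$; $T$ is non-degenerate if $\deg Q_N=N+r$. (Under the stated hypotheses $T(f_i)$ is hyperbolic of degree $n+r$.) Limits of polynomials of fixed degree are coefficientwise. Zero pattern: let $v$ and $f$ be hyperbolic of degrees $r$ and $n$, let $\alpha_1\le\cdots\le\alpha_{n+r}$ be the zeros of $vf$ (with multiplicity), and let $A,B$ be disjoint with $A\cup B=[n+r]$, $|A|=r$, $|B|=n$. The pair $(v,f)$ has zero pattern $(A,B)$ if the zeros of $v$ are $\{\alpha_i:i\in A\}$ and the zeros of $f$ are $\{\alpha_i:i\in B\}$, as multisets (with multiplicity). *)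

theory Defs
  imports "HOL-Analysis.Analysis" "HOL-Computational_Algebra.Computational_Algebra"
begin

definition hyperbolic :: "real poly \<Rightarrow> bool" where
  "hyperbolic p \<longleftrightarrow> p \<noteq> 0 \<and>
     (\<forall>z::complex. poly (map_poly of_real p) z = 0 \<longrightarrow> z \<in> \<real>)"

definition preserves_hyperbolicity :: "(real poly \<Rightarrow> real poly) \<Rightarrow> bool" where
  "preserves_hyperbolicity T \<longleftrightarrow>
     (\<forall>f. hyperbolic f \<longrightarrow> hyperbolic (T f) \<or> T f = 0)"

definition diff_op :: "nat \<Rightarrow> (nat \<Rightarrow> real poly) \<Rightarrow> real poly \<Rightarrow> real poly" where
  "diff_op N Q f = (\<Sum>k\<le>N. Q k * (pderiv ^^ k) f)"

text \<open>The Fuchs index can be negative, hence it is an integer.  It and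
  non-degeneracy are only used for \<open>Q N \<noteq> 0\<close>; coefficients \<open>Q k\<close> with
  \<open>k > N\<close> are ignored throughout.\<close>

definition fuchs_index :: "nat \<Rightarrow> (nat \<Rightarrow> real poly) \<Rightarrow> int" where
  "fuchs_index N Q = Max ((\<lambda>k. int (degree (Q k)) - int k) ` {k. k \<le> N \<and> Q k \<noteq> 0})"

definition nondegenerate :: "nat \<Rightarrow> (nat \<Rightarrow> real poly) \<Rightarrow> bool" where
  "nondegenerate N Q \<longleftrightarrow> int (degree (Q N)) = int N + fuchs_index N Q"

text \<open>A nonzero constant has no smallest zero.  With \<open>e = min n N\<close>, the polynomial
  \<open>Q e\<close> is a nonzero constant only if \<open>r = 0\<close> and \<open>n = 0 \<or> N = 0\<close>; then either
  \<open>(z - a) ^ n = 1\<close> or \<open>T\<close> is multiplication by a constant, and \<open>a\<close> may be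
  arbitrary.\<close>

definition is_smallest_zero :: "real poly \<Rightarrow> real \<Rightarrow> bool" where
  "is_smallest_zero p a \<longleftrightarrow> poly p a = 0 \<and> (\<forall>x. poly p x = 0 \<longrightarrow> a \<le> x)"

text \<open>\<open>sorted_zero p i\<close> is the \<open>i\<close>-th smallest zero of \<open>p\<close>, counted with
  multiplicity and starting from \<open>i = 1\<close>.\<close>

definition sorted_zero :: "real poly \<Rightarrow> nat \<Rightarrow> real" where
  "sorted_zero p i = sorted_list_of_multiset (proots p) ! (i - 1)"

definition zero_pattern :: "real poly \<Rightarrow> real poly \<Rightarrow> nat set \<Rightarrow> nat set \<Rightarrow> bool" where
  "zero_pattern v f A B \<longleftrightarrow>
     hyperbolic v \<and> hyperbolic f \<and>
     A \<inter> B = {} \<and> A \<union> B = {1..degree f + degree v} \<and>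
     card A = degree v \<and> card B = degree f \<and>
     proots v = image_mset (sorted_zero (v * f)) (mset_set A) \<and>
     proots f = image_mset (sorted_zero (v * f)) (mset_set B)"

text \<open>The unique factorization \<open>h = v * f\<close> with \<open>f\<close> monic and prescribed zero
  pattern, as the pair \<open>(v, f)\<close>.  It is meaningful when \<open>h\<close> is hyperbolic and
  \<open>A\<close>, \<open>B\<close> partition \<open>{1..degree h}\<close>.\<close>

definition pattern_factorization ::
    "nat set \<Rightarrow> nat set \<Rightarrow> real poly \<Rightarrow> real poly \<times> real poly" where
  "pattern_factorization A B h =
     (THE vf. h = fst vf * snd vf \<and> lead_coeff (snd vf) = 1 \<and>
        zero_pattern (fst vf) (snd vf) A B)"

definition poly_tendsto :: "(nat \<Rightarrow> real poly) \<Rightarrow> real poly \<Rightarrow> bool" where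
  "poly_tendsto p q \<longleftrightarrow> (\<forall>k. (\<lambda>i. coeff (p i) k) \<longlonglongrightarrow> coeff q k)"

end

(* The relation "zeros_upto g x <= zeros_upto f x for all x" says that the sorted zeros of f are
   dominated by those of g.  If T is a non-degenerate hyperbolicity preserver, then for hyperbolic h
   all polynomials T ((z - t) h) = T (z h) - t T h of the pencil are hyperbolic, so the quotient
   T h / T (z h) is never real in the upper half plane, where its imaginary part has constant sign.
   This forces the zeros of the pencil to move monotonically with t, to the right because the leading
   coefficients of T (z h) and T h have equal signs, and it makes the zeros of T h lie between
   the extreme zeros of T (z h).  Moving zeros one at a time, T is monotone for the order above.

   By the second property the smallest zero of T ((z - x) ^ n) is at least that of
   T ((z - x) ^ M) for M >= n, and for large M the latter tends to the smallest zero of (z - x) Q_N.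
   For n >= N this shows that no zero of T (f_0) is smaller than a; for n < N it holds for x far to
   the left, and no zero of T ((z - x) ^ n) crosses x as x increases to a.  By monotonicity the zeros
   of T (f_i) then increase with i.  For large b they are bounded by the zeros of T ((z - b) ^ n),
   which are at most b, so they converge. *)

theory Submission
  imports Defs "HOL-Computational_Algebra.Field_as_Ring"
begin

section \<open>Hyperbolic polynomials\<close>

abbreviation cpoly :: "real poly \<Rightarrow> complex poly" where
  "cpoly \<equiv> map_poly complex_of_real"

lemma cpoly_add: "cpoly (p + q) = cpoly p + cpoly q"
  by (intro poly_eqI) (simp add: coeff_map_poly)

lemma cpoly_smult: "cpoly (smult c p) = smult (of_real c) (cpoly p)"
  by (intro poly_eqI) (simp add: coeff_map_poly)

lemma cpoly_diff: "cpoly (p - q) = cpoly p - cpoly q"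
  by (intro poly_eqI) (simp add: coeff_map_poly)

lemma cpoly_minus: "cpoly (- p) = - cpoly p"
  by (intro poly_eqI) (simp add: coeff_map_poly)

lemma cpoly_mult: "cpoly (p * q) = cpoly p * cpoly q"
  by (intro poly_eqI) (simp add: coeff_map_poly coeff_mult)

lemma cpoly_eq_0_iff [simp]: "cpoly p = 0 \<longleftrightarrow> p = 0"
  by (simp add: poly_eq_iff coeff_map_poly)

lemma degree_cpoly [simp]: "degree (cpoly p) = degree p"
  by (rule degree_map_poly) simp

lemma poly_cpoly_of_real: "poly (cpoly p) (of_real x) = of_real (poly p x)"
  by (induction p) (simp_all add: map_poly_pCons)

lemma hyperbolic_nonzero: "hyperbolic p \<Longrightarrow> p \<noteq> 0"
  by (simp add: hyperbolic_def)

lemma hyperbolic_mult_iff: "hyperbolic (p * q) \<longleftrightarrow> hyperbolic p \<and> hyperbolic q"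
  by (auto simp: hyperbolic_def cpoly_mult)

lemma hyperbolic_const: "c \<noteq> 0 \<Longrightarrow> hyperbolic [:c:]"
  by (simp add: hyperbolic_def map_poly_pCons)

lemma hyperbolic_1: "hyperbolic 1"
  using hyperbolic_const[of 1] by (simp add: one_pCons)

lemma hyperbolic_linear: "hyperbolic [:- x, 1:]"
proof -
  have "z \<in> \<real>" if "poly (cpoly [:- x, 1:]) z = 0" for z
  proof -
    have "z = of_real x"
      using that by (simp add: map_poly_pCons add_eq_0_iff2)
    then show ?thesis by simp
  qed
  then show ?thesis by (simp add: hyperbolic_def)
qed

lemma hyperbolic_smult_iff: "c \<noteq> 0 \<Longrightarrow> hyperbolic (smult c p) \<longleftrightarrow> hyperbolic p"
  using hyperbolic_mult_iff[of "[:c:]" p] hyperbolic_const[of c] by simp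

lemma hyperbolic_power: "hyperbolic p \<Longrightarrow> hyperbolic (p ^ n)"
  by (induction n) (simp_all add: hyperbolic_1 hyperbolic_mult_iff)

lemma hyperbolic_prod: "(\<And>i. i \<in> I \<Longrightarrow> hyperbolic (g i)) \<Longrightarrow> hyperbolic (\<Prod>i\<in>I. g i)"
  by (induction I rule: infinite_finite_induct) (simp_all add: hyperbolic_1 hyperbolic_mult_iff)

lemma hyperbolic_has_root:
  assumes "hyperbolic p" "degree p > 0"
  shows "\<exists>x. poly p x = 0"
proof -
  have "\<not> constant (poly (cpoly p))"
    using assms(2) by (simp add: constant_degree)
  then obtain z where z: "poly (cpoly p) z = 0"
    using fundamental_theorem_of_algebra by blast
  with assms(1) have "z \<in> \<real>" by (simp add: hyperbolic_def)
  then obtain x where "z = of_real x" by (auto elim: Reals_cases)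
  with z show ?thesis by (auto simp: poly_cpoly_of_real)
qed

lemma hyperbolic_factorization:
  assumes "hyperbolic p"
  shows "p = smult (lead_coeff p) (\<Prod>x\<in>#proots p. [:- x, 1:])"
  using assms
proof (induction "degree p" arbitrary: p)
  case 0
  then obtain c where "p = [:c:]" by (metis degree_eq_zeroE)
  then show ?case by simp
next
  case (Suc n)
  obtain x where "poly p x = 0"
    using hyperbolic_has_root[of p] Suc by auto
  then obtain q where p: "p = [:- x, 1:] * q"
    by (metis poly_eq_0_iff_dvd dvdE)
  have q: "hyperbolic q" using Suc.prems unfolding p hyperbolic_mult_iff by blast
  then have q0: "q \<noteq> 0" by (simp add: hyperbolic_nonzero)
  have "degree p = Suc (degree q)" unfolding p using q0 by (subst degree_mult_eq) auto
  then have "q = smult (lead_coeff q) (\<Prod>x\<in>#proots q. [:- x, 1:])"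
    using Suc q by simp
  moreover have "lead_coeff p = lead_coeff q" unfolding p lead_coeff_mult by simp
  moreover have "proots p = {#x#} + proots q"
    unfolding p using q0 proots_linear_factor[of "- x"] by (subst proots_mult) auto
  then have "(\<Prod>y\<in>#proots p. [:- y, 1:]) = [:- x, 1:] * (\<Prod>y\<in>#proots q. [:- y, 1:])"
    by simp
  ultimately show ?case
    using p by (metis mult_smult_right)
qed

lemma hyperbolic_size_proots:
  assumes "hyperbolic p"
  shows "size (proots p) = degree p"
proof -
  have "degree (\<Prod>x\<in>#M. [:- x, 1:]) = size M" for M :: "real multiset"
  proof (induction M)
    case (add x M)
    have "degree ([:- x, 1:] * (\<Prod>x\<in>#M. [:- x, 1:])) = 1 + degree (\<Prod>x\<in>#M. [:- x, 1:])"
      by (subst degree_mult_eq) (auto simp: prod_mset_zero_iff)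
    with add show ?case by simp
  qed simp
  then show ?thesis
    using arg_cong[OF hyperbolic_factorization[OF assms], of degree] hyperbolic_nonzero[OF assms]
    by simp
qed

lemma proots_prod_linear:
  assumes "finite I"
  shows "proots (\<Prod>i\<in>I. [:- g i, 1:]) = image_mset g (mset_set I)"
  using assms
proof (induction I)
  case (insert i I)
  have "proots ([:- g i, 1:] * (\<Prod>i\<in>I. [:- g i, 1:])) = {#g i#} + proots (\<Prod>i\<in>I. [:- g i, 1:])"
    using insert.hyps proots_linear_factor[of "- g i"] by (subst proots_mult) auto
  with insert show ?case by simp
qed simp

lemma degree_prod_linear: "finite I \<Longrightarrow> degree (\<Prod>i\<in>I. [:- g i :: real, 1:]) = card I"
  by (subst degree_prod_eq_sum_degree) auto

lemma lead_coeff_prod_linear: "lead_coeff (\<Prod>i\<in>I. [:- g i :: real, 1:]) = 1"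
  by (simp add: lead_coeff_prod)

lemma hyperbolic_prod_linear: "hyperbolic (\<Prod>i\<in>I. [:- g i, 1:])"
  by (intro hyperbolic_prod hyperbolic_linear)

text \<open>Divided by the square of the leading coefficient, this says that the sum of the squares
  of the zeros, \<open>e_1^2 - 2 * e_2\<close> in elementary symmetric functions, is nonnegative.
  The proof reverses the coefficients, so that the three top ones get the indices 0, 1, 2.\<close>

lemma hyperbolic_newton:
  assumes "hyperbolic p" "degree p = k + 2"
  shows "2 * coeff p (k + 2) * coeff p k \<le> coeff p (k + 1) ^ 2"
proof -
  have prod: "coeff (\<Prod>x\<in>#M. [:1, - x:]) 0 = 1 \<and>
      coeff (\<Prod>x\<in>#M. [:1, - x:]) 1 ^ 2 \<ge> 2 * coeff (\<Prod>x\<in>#M. [:1, - x:]) 2"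
    for M :: "real multiset"
  proof (induction M)
    case (add x M)
    let ?q = "\<Prod>x\<in>#M. [:1, - x:]"
    have "coeff ([:1, - x:] * ?q) 0 = 1"
      and "coeff ([:1, - x:] * ?q) 1 = coeff ?q 1 - x"
      and "coeff ([:1, - x:] * ?q) 2 = coeff ?q 2 - x * coeff ?q 1"
      using add by (simp_all add: coeff_pCons numeral_2_eq_2 split: nat.splits)
    moreover have "(coeff ?q 1 - x)\<^sup>2 - 2 * (coeff ?q 2 - x * coeff ?q 1) = (coeff ?q 1)\<^sup>2 - 2 * coeff ?q 2 + x\<^sup>2"
      by (simp add: power2_eq_square algebra_simps)
    then have "2 * (coeff ?q 2 - x * coeff ?q 1) \<le> (coeff ?q 1 - x)\<^sup>2"
      using add zero_le_power2[of x] by linarith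
    ultimately show ?case by simp
  qed simp
  have refl: "reflect_poly (\<Prod>x\<in>#M. [:- x, 1:]) = (\<Prod>x\<in>#M. [:1, - x:])" for M :: "real multiset"
  proof (induction M)
    case (add x M)
    have "reflect_poly ([:- x, 1:] * (\<Prod>x\<in>#M. [:- x, 1:])) = [:1, - x:] * (\<Prod>x\<in>#M. [:1, - x:])"
      unfolding reflect_poly_mult add by (simp add: reflect_poly_def)
    then show ?case by simp
  qed simp
  define c where "c = lead_coeff p"
  define q where "q = (\<Prod>x\<in>#proots p. [:1, - x:])"
  have eq: "reflect_poly p = smult c q"
    using arg_cong[OF hyperbolic_factorization[OF assms(1)], of reflect_poly] refl
    by (simp add: reflect_poly_smult c_def q_def)
  have "coeff p (k + 2) = c * coeff q 0" "coeff p (k + 1) = c * coeff q 1" "coeff p k = c * coeff q 2"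
    using arg_cong[OF eq, of "\<lambda>q. coeff q 0"] arg_cong[OF eq, of "\<lambda>q. coeff q 1"]
      arg_cong[OF eq, of "\<lambda>q. coeff q 2"] assms(2)
    by (simp_all add: coeff_reflect_poly)
  moreover have "c\<^sup>2 * (2 * coeff q 0 * coeff q 2) \<le> c\<^sup>2 * (coeff q 1)\<^sup>2"
    using prod[of "proots p"] unfolding q_def by (intro mult_left_mono) auto
  ultimately show ?thesis by (simp add: power2_eq_square algebra_simps)
qed

section \<open>Quotients of hyperbolic polynomials in the upper half plane\<close>

text \<open>Letting \<open>\<rho> cis \<theta>\<close> approach the singularity along two suitable rays makes the imaginary part
  of \<open>\<Phi> \<approx> c / z ^ d\<close> take the sign of \<open>- c\<close>, and also of \<open>c\<close> if \<open>d \<ge> 2\<close>.\<close>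

lemma simple_pole_of_Im_neg:
  fixes \<Phi> :: "real \<Rightarrow> real \<Rightarrow> complex" and c :: real
  assumes "F \<noteq> bot" "d \<ge> 1" "c \<noteq> 0"
    and lim: "\<And>\<theta>. 0 < \<theta> \<Longrightarrow> \<theta> < pi \<Longrightarrow>
      ((\<lambda>\<rho>. \<Phi> \<theta> \<rho> * cis \<theta> ^ d * of_real (\<rho> ^ d)) \<longlongrightarrow> of_real c) F"
    and neg: "\<And>\<theta>. 0 < \<theta> \<Longrightarrow> \<theta> < pi \<Longrightarrow> eventually (\<lambda>\<rho>. Im (\<Phi> \<theta> \<rho>) < 0) F"
    and pos: "eventually (\<lambda>\<rho>. \<rho> > 0) F"
  shows "d = 1 \<and> c > 0"
proof -
  \<comment> \<open>Since \<open>w\<close> has modulus 1, multiplying by \<open>cnj w\<close> undoes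
    the rotation: \<open>\<Phi> \<theta> \<rho> * \<rho> ^ d\<close> itself tends to
    \<open>cnj w * c\<close>, and the sign of its imaginary part survives in the limit.\<close>
  have ray: "Im (cnj w * of_real c) \<le> 0" if "0 < \<theta>" "\<theta> < pi" "cis \<theta> ^ d = w" for \<theta> w
  proof -
    have w: "w * cnj w = 1"
      using that(3) by (auto simp: Complex.DeMoivre cis_cnj cis_mult)
    have "((\<lambda>\<rho>. cnj w * (\<Phi> \<theta> \<rho> * cis \<theta> ^ d * of_real (\<rho> ^ d))) \<longlongrightarrow> cnj w * of_real c) F"
      using lim that by (intro tendsto_mult_left) auto
    also have "(\<lambda>\<rho>. cnj w * (\<Phi> \<theta> \<rho> * cis \<theta> ^ d * of_real (\<rho> ^ d))) = (\<lambda>\<rho>. \<Phi> \<theta> \<rho> * of_real (\<rho> ^ d))"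
      using w unfolding that(3) by (simp add: fun_eq_iff mult_ac)
    finally have "((\<lambda>\<rho>. Im (\<Phi> \<theta> \<rho> * of_real (\<rho> ^ d))) \<longlongrightarrow> Im (cnj w * of_real c)) F"
      by (rule tendsto_Im)
    moreover have "eventually (\<lambda>\<rho>. Im (\<Phi> \<theta> \<rho> * of_real (\<rho> ^ d)) \<le> 0) F"
      using neg[OF that(1,2)] pos
      by eventually_elim (simp add: mult_le_0_iff flip: of_real_power)
    ultimately show ?thesis using \<open>F \<noteq> bot\<close> by (rule tendsto_upperbound)
  qed
  have d: "real d \<ge> 1" using assms by simp
  \<comment> \<open>For \<open>w = \<i>\<close> the ray inequality reads \<open>- c \<le> 0\<close>.
    The direction with \<open>w = - \<i>\<close> below is available only for
    \<open>d \<ge> 2\<close>, because \<open>3 * pi / (2 * d)\<close> must be less than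
    \<open>pi\<close>.\<close>
  have "cis (pi / (2 * d)) ^ d = \<i>"
    using d by (simp add: Complex.DeMoivre field_simps)
  moreover have "pi / (2 * d) < pi" using d by (simp add: field_simps)
  ultimately have "c \<ge> 0" using ray[of "pi / (2 * d)" \<i>] d by simp
  with assms have c: "c > 0" by simp
  have "d < 2"
  proof (rule ccontr)
    assume "\<not> d < 2"
    then have d: "real d \<ge> 2" by simp
    have "cis (3 * pi / (2 * d)) ^ d = cis (pi + pi / 2)"
      using d by (simp add: Complex.DeMoivre field_simps)
    also have "\<dots> = - \<i>" unfolding cis_mult [symmetric] by simp
    finally have "cis (3 * pi / (2 * d)) ^ d = - \<i>" .
    moreover have "3 * pi / (2 * d) < pi" using d by (simp add: field_simps)
    ultimately have "c \<le> 0" using ray[of "3 * pi / (2 * d)" "- \<i>"] d by simp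
    with c show False by simp
  qed
  with c assms show ?thesis by simp
qed

text \<open>A real value \<open>w\<close> of \<open>R / P\<close> in the half plane is nonzero,
  since \<open>R\<close> has no zero there, and makes the point a zero of
  \<open>P - smult (1 / w) R\<close>. So the imaginary part never vanishes, and by connectedness it
  cannot change sign.\<close>

lemma Im_quotient_sign_pencil:
  assumes P: "hyperbolic P" and R: "hyperbolic R" and pencil: "\<And>u. hyperbolic (P - smult u R)"
  shows "(\<forall>z. Im z > 0 \<longrightarrow> Im (poly (cpoly R) z / poly (cpoly P) z) < 0) \<or>
         (\<forall>z. Im z > 0 \<longrightarrow> Im (poly (cpoly R) z / poly (cpoly P) z) > 0)"
proof -
  define H where "H = {z. Im z > 0}"
  define \<Phi> where "\<Phi> z = Im (poly (cpoly R) z / poly (cpoly P) z)" for z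
  have nz: "poly (cpoly p) z \<noteq> 0" if "hyperbolic p" "z \<in> H" for p z
    using that by (force simp: hyperbolic_def H_def complex_is_Real_iff)
  have \<Phi>0: "\<Phi> z \<noteq> 0" if "z \<in> H" for z
  proof
    assume "\<Phi> z = 0"
    then obtain w where w: "poly (cpoly R) z / poly (cpoly P) z = of_real w"
      unfolding \<Phi>_def using complex_is_Real_iff Reals_cases by metis
    have nz': "poly (cpoly R) z \<noteq> 0" "poly (cpoly P) z \<noteq> 0" using nz P R that by auto
    then have "w \<noteq> 0" using w by auto
    have "poly (cpoly (P - smult (1 / w) R)) z = 0"
      using nz' w \<open>w \<noteq> 0\<close> by (simp add: cpoly_diff cpoly_smult field_simps)
    then show False using nz[OF pencil that] by blast
  qed
  have "connected H" unfolding H_def by (intro convex_connected convex_halfspace_Im_gt)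
  moreover have "continuous_on H \<Phi>"
    unfolding \<Phi>_def using nz[OF P] by (intro continuous_intros) auto
  ultimately have conn: "connected (\<Phi> ` H)" by (rule connected_continuous_image[rotated])
  have "False" if "z \<in> H" "w \<in> H" "\<Phi> z < 0" "\<Phi> w > 0" for z w
    using connectedD_interval[OF conn, of "\<Phi> z" "\<Phi> w" 0] that \<Phi>0 by force
  then show ?thesis
    using \<Phi>0 unfolding H_def \<Phi>_def by (metis (mono_tags, lifting) linorder_neqE_linordered_idom mem_Collect_eq)
qed

text \<open>At infinity the quotient behaves like \<open>c / z ^ d\<close> with \<open>c\<close> the
  ratio of the leading coefficients and \<open>d\<close> the drop in degree; rays going to infinity
  leave only \<open>d = 1\<close> and \<open>c > 0\<close>.\<close>

lemma degree_of_Im_quotient_neg: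
  assumes "P \<noteq> 0" "R \<noteq> 0" "degree R < degree P"
    and neg: "\<And>z. Im z > 0 \<Longrightarrow> Im (poly (cpoly R) z / poly (cpoly P) z) < 0"
  shows "degree P = Suc (degree R) \<and> lead_coeff R / lead_coeff P > 0"
proof -
  define d where "d = degree P - degree R"
  define \<Phi> where "\<Phi> \<theta> \<rho> = poly (cpoly R) (cis \<theta> * of_real \<rho>) / poly (cpoly P) (cis \<theta> * of_real \<rho>)" for \<theta> \<rho> :: real
  have "d = 1 \<and> lead_coeff R / lead_coeff P > 0"
  proof (rule simple_pole_of_Im_neg[where F = at_top and \<Phi> = \<Phi>])
    fix \<theta> :: real assume \<theta>: "0 < \<theta>" "\<theta> < pi"
    have inf: "filterlim (\<lambda>\<rho>. cis \<theta> * of_real \<rho> :: complex) at_infinity at_top"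
      by (rule tendsto_mult_filterlim_at_infinity[where c = "cis \<theta>"])
         (auto intro!: filterlim_compose[OF filterlim_of_real_at_infinity] filterlim_ident)
    define q where "q p z = poly (cpoly p) z / z ^ degree p" for p and z :: complex
    have q: "((\<lambda>\<rho>. q p (cis \<theta> * of_real \<rho>)) \<longlongrightarrow> of_real (lead_coeff p)) at_top" for p
      using filterlim_compose[OF poly_divide_tendsto_aux[of "cpoly p"] inf]
      unfolding q_def by (simp add: coeff_map_poly)
    have "((\<lambda>\<rho>. q R (cis \<theta> * of_real \<rho>) / q P (cis \<theta> * of_real \<rho>)) \<longlongrightarrow>
        of_real (lead_coeff R) / of_real (lead_coeff P)) at_top"
      using assms by (intro tendsto_divide q) auto
    moreover have "eventually (\<lambda>\<rho>. q R (cis \<theta> * of_real \<rho>) / q P (cis \<theta> * of_real \<rho>) =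
        \<Phi> \<theta> \<rho> * cis \<theta> ^ d * of_real (\<rho> ^ d)) at_top"
      using eventually_gt_at_top[of 0]
    proof eventually_elim
      case (elim \<rho>)
      have "(cis \<theta> * of_real \<rho>) ^ degree P = (cis \<theta> * of_real \<rho>) ^ degree R * (cis \<theta> * of_real \<rho>) ^ d"
        using assms(3) by (simp add: d_def flip: power_add)
      then show ?case
        using elim unfolding q_def \<Phi>_def by (simp add: power_mult_distrib divide_simps)
    qed
    ultimately show "((\<lambda>\<rho>. \<Phi> \<theta> \<rho> * cis \<theta> ^ d * of_real (\<rho> ^ d)) \<longlongrightarrow>
        of_real (lead_coeff R / lead_coeff P)) at_top"
      by (simp add: tendsto_cong)
    show "\<forall>\<^sub>F \<rho> in at_top. Im (\<Phi> \<theta> \<rho>) < 0"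
      using eventually_gt_at_top[of 0]
      by eventually_elim (auto simp: \<Phi>_def \<theta> sin_gt_zero intro!: neg)
  qed (use assms eventually_gt_at_top in \<open>auto simp: d_def\<close>)
  then show ?thesis using assms(3) by (auto simp: d_def)
qed

text \<open>The quotient has a pole of order \<open>order a P\<close> at \<open>a\<close>.
  Approaching it along rays shows that the pole is simple with positive residue
  \<open>poly R a / poly (pderiv P) a\<close>.\<close>

lemma simple_zero_of_Im_quotient_neg:
  assumes "P \<noteq> 0" "poly P a = 0" "poly R a \<noteq> 0"
    and neg: "\<And>z. Im z > 0 \<Longrightarrow> Im (poly (cpoly R) z / poly (cpoly P) z) < 0"
  shows "order a P = 1 \<and> poly R a * poly (pderiv P) a > 0"
proof -
  define d where "d = order a P"
  obtain q where P: "P = [:- a, 1:] ^ d * q" and q: "poly q a \<noteq> 0"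
    using order_decomp[OF assms(1), of a] unfolding d_def poly_eq_0_iff_dvd by blast
  have d1: "d \<ge> 1" using assms(1,2) order_root[of P a] by (simp add: d_def)
  have cP: "poly (cpoly P) z = (z - of_real a) ^ d * poly (cpoly q) z" for z
  proof -
    have "poly (cpoly ([:- a, 1:] ^ k)) z = (z - of_real a) ^ k" for k
      by (induction k) (simp_all add: cpoly_smult cpoly_diff cpoly_add map_poly_pCons algebra_simps)
    then show ?thesis by (simp add: P cpoly_mult)
  qed
  define \<Phi> where "\<Phi> \<theta> \<rho> = poly (cpoly R) (of_real a + cis \<theta> * of_real \<rho>) /
    poly (cpoly P) (of_real a + cis \<theta> * of_real \<rho>)" for \<theta> \<rho> :: real
  have "d = 1 \<and> poly R a / poly q a > 0"
  proof (rule simple_pole_of_Im_neg[where F = "at_right 0" and \<Phi> = \<Phi>])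
    fix \<theta> :: real assume \<theta>: "0 < \<theta>" "\<theta> < pi"
    have "isCont (\<lambda>\<rho>. poly (cpoly R) (of_real a + cis \<theta> * of_real \<rho>) /
        poly (cpoly q) (of_real a + cis \<theta> * of_real \<rho>)) 0"
      using q by (intro continuous_intros) (auto simp: poly_cpoly_of_real)
    then have "((\<lambda>\<rho>. poly (cpoly R) (of_real a + cis \<theta> * of_real \<rho>) /
        poly (cpoly q) (of_real a + cis \<theta> * of_real \<rho>)) \<longlongrightarrow> of_real (poly R a / poly q a)) (at_right 0)"
      by (auto simp: isCont_def poly_cpoly_of_real intro: tendsto_within_subset)
    moreover have "eventually (\<lambda>\<rho>. poly (cpoly R) (of_real a + cis \<theta> * of_real \<rho>) /
        poly (cpoly q) (of_real a + cis \<theta> * of_real \<rho>) = \<Phi> \<theta> \<rho> * cis \<theta> ^ d * of_real (\<rho> ^ d)) (at_right 0)"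
      using eventually_at_right_less[of 0]
      by eventually_elim (simp add: \<Phi>_def cP power_mult_distrib)
    ultimately show "((\<lambda>\<rho>. \<Phi> \<theta> \<rho> * cis \<theta> ^ d * of_real (\<rho> ^ d)) \<longlongrightarrow>
        of_real (poly R a / poly q a)) (at_right 0)"
      by (simp add: tendsto_cong)
    show "\<forall>\<^sub>F \<rho> in at_right 0. Im (\<Phi> \<theta> \<rho>) < 0"
      using eventually_at_right_less[of 0]
      by eventually_elim (auto simp: \<Phi>_def \<theta> sin_gt_zero intro!: neg)
  qed (use assms d1 q eventually_at_right_less in auto)
  moreover from this have "poly (pderiv P) a = poly q a"
    by (simp add: P pderiv_diff pderiv_smult pderiv_pCons)
  ultimately show ?thesis
    by (auto simp: d_def zero_less_divide_iff zero_less_mult_iff)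
qed

section \<open>Counting and sorting zeros\<close>

text \<open>Comparing these counting functions pointwise expresses domination of sorted zeros
  without lists, and a common factor of two polynomials adds the same amount to both sides.\<close>

definition zeros_upto :: "real poly \<Rightarrow> real \<Rightarrow> nat" where
  "zeros_upto p x = size (filter_mset (\<lambda>y. y \<le> x) (proots p))"

lemma zeros_upto_mult:
  "p \<noteq> 0 \<Longrightarrow> q \<noteq> 0 \<Longrightarrow> zeros_upto (p * q) x = zeros_upto p x + zeros_upto q x"
  by (simp add: zeros_upto_def proots_mult)

lemma zeros_upto_smult: "c \<noteq> 0 \<Longrightarrow> zeros_upto (smult c p) x = zeros_upto p x"
  by (simp add: zeros_upto_def)

lemma zeros_upto_pos_iff:
  assumes "p \<noteq> 0"
  shows "zeros_upto p x > 0 \<longleftrightarrow> (\<exists>y\<le>x. poly p y = 0)"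
proof -
  have "zeros_upto p x > 0 \<longleftrightarrow> filter_mset (\<lambda>y. y \<le> x) (proots p) \<noteq> {#}"
    unfolding zeros_upto_def by (rule nonempty_has_size [symmetric])
  also have "\<dots> \<longleftrightarrow> (\<exists>y\<in>set_mset (proots p). y \<le> x)"
    by (auto simp: filter_mset_eq_mempty_iff)
  finally show ?thesis using assms by auto
qed

lemma nth_le_iff_length_filter:
  fixes xs :: "'a::linorder list"
  assumes "sorted xs" "k < length xs"
  shows "xs ! k \<le> x \<longleftrightarrow> k < length (filter (\<lambda>y. y \<le> x) xs)"
  using assms
proof (induction xs arbitrary: k)
  case (Cons a xs)
  show ?case
  proof (cases "a \<le> x")
    case True
    then show ?thesis using Cons by (cases k) auto
  next
    case False
    then have "filter (\<lambda>y. y \<le> x) (a # xs) = []"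
      using Cons.prems(1) by (auto simp: filter_empty_conv)
    moreover have "a \<le> (a # xs) ! k" using Cons.prems by (cases k) auto
    ultimately show ?thesis using False by auto
  qed
qed simp

text \<open>The zeros not exceeding \<open>x\<close> form an initial segment of the sorted list.
  This is the bridge between sorted zeros and counting functions.\<close>

lemma sorted_zero_le_iff:
  assumes "1 \<le> j" "j \<le> size (proots p)"
  shows "sorted_zero p j \<le> x \<longleftrightarrow> j \<le> zeros_upto p x"
proof -
  let ?xs = "sorted_list_of_multiset (proots p)"
  have len: "length ?xs = size (proots p)"
    by (metis mset_sorted_list_of_multiset size_mset)
  have "mset (filter (\<lambda>y. y \<le> x) ?xs) = filter_mset (\<lambda>y. y \<le> x) (proots p)"
    by simp
  then have "zeros_upto p x = length (filter (\<lambda>y. y \<le> x) ?xs)"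
    unfolding zeros_upto_def by (metis size_mset)
  then show ?thesis
    using nth_le_iff_length_filter[of ?xs "j - 1" x] assms len
    by (auto simp: sorted_zero_def)
qed

lemma sorted_zero_mono_of_zeros_upto:
  assumes "\<And>x. zeros_upto q x \<le> zeros_upto p x"
    and "1 \<le> j" "j \<le> size (proots p)" "j \<le> size (proots q)"
  shows "sorted_zero p j \<le> sorted_zero q j"
  using assms sorted_zero_le_iff[of j p "sorted_zero q j"] sorted_zero_le_iff[of j q "sorted_zero q j"]
  by (meson order.refl order.trans)

lemma sorted_zero_root:
  assumes "1 \<le> j" "j \<le> size (proots p)"
  shows "poly p (sorted_zero p j) = 0"
proof -
  let ?xs = "sorted_list_of_multiset (proots p)"
  have len: "length ?xs = size (proots p)"
    by (metis mset_sorted_list_of_multiset size_mset)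
  have "?xs ! (j - 1) \<in> set ?xs" using assms len by (intro nth_mem) auto
  then have "sorted_zero p j \<in># proots p" by (simp add: sorted_zero_def)
  then show ?thesis by (cases "p = 0") auto
qed

lemma image_sorted_zero:
  "image_mset (sorted_zero p) (mset_set {1..size (proots p)}) = proots p"
proof -
  let ?xs = "sorted_list_of_multiset (proots p)"
  have len: "length ?xs = size (proots p)"
    by (metis mset_sorted_list_of_multiset size_mset)
  have "mset_set {1..size (proots p)} = image_mset Suc (mset_set {0..<size (proots p)})"
    by (simp add: image_mset_mset_set image_Suc_atLeastLessThan atLeastLessThanSuc_atLeastAtMost)
  then have "image_mset (sorted_zero p) (mset_set {1..size (proots p)}) =
      image_mset ((!) ?xs) (mset_set {0..<length ?xs})"
    by (simp add: image_mset.compositionality o_def sorted_zero_def len)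
  also have "\<dots> = mset (map ((!) ?xs) [0..<length ?xs])"
    by (simp add: mset_map mset_upt)
  finally show ?thesis by (simp add: map_nth)
qed

lemma sorted_zero_mono:
  assumes "1 \<le> i" "i \<le> j" "j \<le> size (proots p)"
  shows "sorted_zero p i \<le> sorted_zero p j"
  using sorted_zero_le_iff[of i p "sorted_zero p j"] sorted_zero_le_iff[of j p "sorted_zero p j"] assms
  by auto

lemma sorted_zero_of_sorted:
  assumes "proots p = image_mset g (mset_set {1..m})"
    and "\<And>i j. 1 \<le> i \<Longrightarrow> i \<le> j \<Longrightarrow> j \<le> m \<Longrightarrow> g i \<le> g j"
    and "1 \<le> k" "k \<le> m"
  shows "sorted_zero p k = g k"
proof -
  let ?xs = "map (\<lambda>i. g (Suc i)) [0..<m]"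
  have "mset_set {1..m} = image_mset Suc (mset_set {0..<m})"
    by (simp add: image_mset_mset_set image_Suc_atLeastLessThan atLeastLessThanSuc_atLeastAtMost)
  then have "proots p = mset ?xs"
    by (simp add: assms(1) image_mset.compositionality o_def mset_upt)
  moreover have "sorted ?xs"
    using assms(2) by (auto simp: sorted_iff_nth_mono)
  ultimately have "sorted_list_of_multiset (proots p) = ?xs"
    by (metis sorted_list_of_multiset_mset sorted_sort_id)
  then show ?thesis using assms(3,4) by (cases k) (simp_all add: sorted_zero_def del: upt_Suc)
qed

section \<open>Sign alternation at the zeros of a product of linear factors\<close>

lemma pderiv_prod_linear_at:
  fixes \<alpha> :: "nat \<Rightarrow> real"
  assumes "k < m"
  shows "poly (pderiv (\<Prod>i<m. [:- \<alpha> i, 1:])) (\<alpha> k) = (\<Prod>i\<in>{..<m} - {k}. \<alpha> k - \<alpha> i)"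
proof -
  have "(\<Prod>i<m. [:- \<alpha> i, 1:]) = [:- \<alpha> k, 1:] * (\<Prod>i\<in>{..<m} - {k}. [:- \<alpha> i, 1:])"
    using assms by (subst prod.remove[of "{..<m}" k]) auto
  then show ?thesis
    by (simp add: pderiv_diff pderiv_smult pderiv_pCons poly_prod)
qed

text \<open>Of the factors \<open>\<alpha> k - \<alpha> i\<close> exactly the
  \<open>m - 1 - k\<close> ones with \<open>i > k\<close> are negative.\<close>

lemma sgn_pderiv_prod_linear_at:
  fixes \<alpha> :: "nat \<Rightarrow> real"
  assumes "strict_mono_on {..<m} \<alpha>" "k < m"
  shows "(-1) ^ (m - 1 - k) * poly (pderiv (\<Prod>i<m. [:- \<alpha> i, 1:])) (\<alpha> k) > 0"
proof -
  have mono: "\<alpha> i < \<alpha> j" if "i < j" "j < m" for i j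
    using that by (intro strict_mono_onD[OF assms(1)]) auto
  have "{..<m} - {k} = {..<k} \<union> {k<..<m}" using assms(2) by auto
  then have "(\<Prod>i\<in>{..<m} - {k}. \<alpha> k - \<alpha> i) = (\<Prod>i<k. \<alpha> k - \<alpha> i) * (\<Prod>i\<in>{k<..<m}. \<alpha> k - \<alpha> i)"
    using prod.union_disjoint[of "{..<k}" "{k<..<m}" "\<lambda>i. \<alpha> k - \<alpha> i"] by fastforce
  also have "(\<Prod>i\<in>{k<..<m}. \<alpha> k - \<alpha> i) = (\<Prod>i\<in>{k<..<m}. (-1) * (\<alpha> i - \<alpha> k))" by simp
  also have "\<dots> = (-1) ^ (m - 1 - k) * (\<Prod>i\<in>{k<..<m}. \<alpha> i - \<alpha> k)"
    unfolding prod.distrib by simp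
  finally have "(-1) ^ (m - 1 - k) * poly (pderiv (\<Prod>i<m. [:- \<alpha> i, 1:])) (\<alpha> k) =
      (\<Prod>i<k. \<alpha> k - \<alpha> i) * (\<Prod>i\<in>{k<..<m}. \<alpha> i - \<alpha> k)"
    using assms(2) by (simp add: pderiv_prod_linear_at flip: power_mult_distrib)
  also have "\<dots> > 0"
    using mono assms(2) by (intro mult_pos_pos prod_pos) auto
  finally show ?thesis .
qed

text \<open>Signs at neighbouring points are opposite, so the intermediate value theorem applies in
  each gap.\<close>

lemma alternating_signs_zeros:
  fixes \<alpha> :: "nat \<Rightarrow> real"
  assumes "strict_mono_on {..<m} \<alpha>"
    and sgn: "\<And>k. k < m \<Longrightarrow> (-1) ^ (m - 1 - k) * poly S (\<alpha> k) > 0"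
  obtains \<sigma> where "\<And>k. Suc k < m \<Longrightarrow> \<alpha> k < \<sigma> k \<and> \<sigma> k < \<alpha> (Suc k) \<and> poly S (\<sigma> k) = 0"
proof -
  have "\<exists>x. \<alpha> k < x \<and> x < \<alpha> (Suc k) \<and> poly S x = 0" if k: "Suc k < m" for k
  proof -
    have less: "\<alpha> k < \<alpha> (Suc k)" using k by (intro strict_mono_onD[OF assms(1)]) auto
    define e :: real where "e = (-1) ^ (m - 1 - Suc k)"
    have "m - 1 - k = Suc (m - 1 - Suc k)" using k by simp
    then have e: "(-1) ^ (m - 1 - k) = - e" by (simp add: e_def)
    have "0 < (e * poly S (\<alpha> (Suc k))) * (- e * poly S (\<alpha> k))"
      by (rule mult_pos_pos) (use sgn[OF k] sgn[OF Suc_lessD[OF k]] in \<open>simp_all only: e e_def [symmetric]\<close>)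
    also have "\<dots> = - (e * e) * (poly S (\<alpha> k) * poly S (\<alpha> (Suc k)))" by simp
    also have "e * e = 1" by (simp add: e_def flip: power_mult_distrib)
    finally have "poly S (\<alpha> k) * poly S (\<alpha> (Suc k)) < 0" by simp
    with less show ?thesis using poly_IVT by blast
  qed
  then show ?thesis using that by metis
qed

text \<open>The \<open>m - 1\<close> gaps between the points supply \<open>m - 1 = degree S\<close>
  distinct zeros, hence all of them.\<close>

lemma alternating_signs_zeros_between:
  fixes \<alpha> :: "nat \<Rightarrow> real"
  assumes \<alpha>: "strict_mono_on {..<m} \<alpha>"
    and sgn: "\<And>k. k < m \<Longrightarrow> (-1) ^ (m - 1 - k) * poly S (\<alpha> k) > 0"
    and "Suc (degree S) = m" "S \<noteq> 0" "poly S x = 0"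
  shows "\<alpha> 0 \<le> x \<and> x \<le> \<alpha> (m - 1)"
proof -
  obtain \<sigma> where \<sigma>: "\<And>k. Suc k < m \<Longrightarrow> \<alpha> k < \<sigma> k \<and> \<sigma> k < \<alpha> (Suc k) \<and> poly S (\<sigma> k) = 0"
    using alternating_signs_zeros[OF \<alpha> sgn] by blast
  have le: "\<alpha> i \<le> \<alpha> j" if "i \<le> j" "j < m" for i j
    using that strict_mono_onD[OF \<alpha>, of i j] by (cases "i = j") auto
  have "\<sigma> i < \<sigma> j" if "i < j" "j < m - 1" for i j
  proof -
    have "Suc i < m" "Suc j < m" "j < m" using that by auto
    then show ?thesis using \<sigma>[of i] \<sigma>[of j] le[of "Suc i" j] that by linarith
  qed
  then have "inj_on \<sigma> {..<m - 1}"
    by (intro linorder_inj_onI') (auto, metis less_irrefl)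
  then have "card (\<sigma> ` {..<m - 1}) = degree S" using assms(3) by (simp add: card_image)
  moreover have "\<sigma> ` {..<m - 1} \<subseteq> {x. poly S x = 0}" using \<sigma> by auto
  moreover have "card {x. poly S x = 0} \<le> degree S" using \<open>S \<noteq> 0\<close> by (rule card_poly_roots_bound)
  ultimately have "{x. poly S x = 0} = \<sigma> ` {..<m - 1}"
    using poly_roots_finite[OF \<open>S \<noteq> 0\<close>] by (metis card_seteq)
  then obtain k where "k < m - 1" "x = \<sigma> k" using assms(5) by auto
  then show ?thesis
    using \<sigma>[of k] le[of 0 k] le[of "Suc k" "m - 1"] by force
qed

text \<open>At \<open>\<alpha> k\<close> the product vanishes, so the difference has the value
  \<open>- \<delta> * poly S (\<alpha> k)\<close>. It therefore has a zero in each gap and, being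
  monic and negative at the last point, one more beyond it. Each of these \<open>m\<close> zeros
  lies to the right of the corresponding \<open>\<alpha> k\<close>.\<close>

lemma alternating_signs_shift_zeros:
  fixes \<alpha> :: "nat \<Rightarrow> real" and S :: "real poly"
  assumes \<alpha>: "strict_mono_on {..<m} \<alpha>"
    and sgn: "\<And>k. k < m \<Longrightarrow> (-1) ^ (m - 1 - k) * poly S (\<alpha> k) > 0"
    and "degree S < m" "\<delta> > 0"
  shows "zeros_upto ((\<Prod>i<m. [:- \<alpha> i, 1:]) - smult \<delta> S) x \<le> zeros_upto (\<Prod>i<m. [:- \<alpha> i, 1:]) x"
proof -
  define F where "F = (\<Prod>i<m. [:- \<alpha> i, 1:])"
  define G where "G = F - smult \<delta> S"
  have F: "degree F = m" "lead_coeff F = 1"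
    using degree_prod_linear[of "{..<m}" \<alpha>] lead_coeff_prod_linear[of \<alpha> "{..<m}"] unfolding F_def by auto
  have S: "degree (- smult \<delta> S) < degree F" using assms by (simp add: F)
  then have degG: "degree G = m"
    unfolding G_def diff_conv_add_uminus by (subst degree_add_eq_left) (auto simp: F)
  moreover have "coeff G m = 1"
    using F assms by (simp add: G_def coeff_eq_0)
  ultimately have G: "degree G = m" "lead_coeff G = 1" by simp_all
  then have "G \<noteq> 0" by auto
  have Fz: "poly F (\<alpha> k) = 0" if "k < m" for k
    using that by (auto simp: F_def poly_prod)
  have sgnG: "(-1) ^ (m - 1 - k) * poly (- G) (\<alpha> k) > 0" if "k < m" for k
  proof -
    have "(-1) ^ (m - 1 - k) * poly (- G) (\<alpha> k) = \<delta> * ((-1) ^ (m - 1 - k) * poly S (\<alpha> k))"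
      using Fz that by (simp add: G_def)
    then show ?thesis using sgn[OF that] \<open>\<delta> > 0\<close> by simp
  qed
  obtain \<sigma> where \<sigma>: "\<And>k. Suc k < m \<Longrightarrow> \<alpha> k < \<sigma> k \<and> \<sigma> k < \<alpha> (Suc k) \<and> poly (- G) (\<sigma> k) = 0"
    using alternating_signs_zeros[OF \<alpha> sgnG] by blast
  have "m > 0" using assms by simp
  then have "poly G (\<alpha> (m - 1)) < 0" using sgnG[of "m - 1"] by simp
  moreover obtain y where y: "\<And>x. x \<ge> y \<Longrightarrow> poly G x \<ge> lead_coeff G"
    using poly_pinfty_gt_lc[of G] G by auto
  then have "poly G (max y (\<alpha> (m - 1) + 1)) > 0" using G by (smt (verit) max.cobounded1)
  ultimately obtain \<tau> where \<tau>: "\<alpha> (m - 1) < \<tau>" "poly G \<tau> = 0"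
    using poly_IVT_pos[of "\<alpha> (m - 1)" "max y (\<alpha> (m - 1) + 1)" G] by (auto simp: less_max_iff_disj)
  define \<beta> where "\<beta> k = (if Suc k < m then \<sigma> k else \<tau>)" for k
  have \<beta>: "\<alpha> k < \<beta> k" "poly G (\<beta> k) = 0" "Suc k < m \<Longrightarrow> \<beta> k < \<alpha> (Suc k)" if "k < m" for k
  proof -
    have "k = m - 1" if "\<not> Suc k < m" using that \<open>k < m\<close> by simp
    then show "\<alpha> k < \<beta> k" "poly G (\<beta> k) = 0" "Suc k < m \<Longrightarrow> \<beta> k < \<alpha> (Suc k)"
      using \<sigma>[of k] \<tau> by (cases "Suc k < m"; simp add: \<beta>_def)+
  qed
  have le: "\<alpha> i \<le> \<alpha> j" if "i \<le> j" "j < m" for i j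
    using that strict_mono_onD[OF \<alpha>, of i j] by (cases "i = j") auto
  have "\<beta> i < \<beta> j" if "i < j" "j < m" for i j
    using \<beta>[of i] \<beta>[of j] le[of "Suc i" j] that by auto
  then have inj: "inj_on \<beta> {..<m}"
    by (intro linorder_inj_onI') (auto, metis less_irrefl)
  \<comment> \<open>The \<open>\<beta> k\<close> are \<open>m\<close> distinct zeros of a polynomial
    of degree \<open>m\<close>, so the inclusion of multisets is an equality by size.\<close>
  have "mset_set (\<beta> ` {..<m}) \<subseteq># proots G"
  proof (rule mset_subset_eqI)
    fix y
    have "order y G \<ge> 1" if "y \<in> \<beta> ` {..<m}"
      using that \<beta>(2) \<open>G \<noteq> 0\<close> order_root[of G y] by (auto simp: Suc_le_eq)
    then show "count (mset_set (\<beta> ` {..<m})) y \<le> count (proots G) y"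
      using \<open>G \<noteq> 0\<close> by (cases "y \<in> \<beta> ` {..<m}") auto
  qed
  moreover have "size (proots G) \<le> size (mset_set (\<beta> ` {..<m}))"
    using size_proots_le[of G] inj by (simp add: G card_image)
  ultimately have "proots G = mset_set (\<beta> ` {..<m})"
    by (metis size_mset_mono mset_subset_size subset_mset.less_le not_less)
  then have pG: "proots G = image_mset \<beta> (mset_set {..<m})"
    using inj by (simp add: image_mset_mset_set)
  have pF: "proots F = image_mset \<alpha> (mset_set {..<m})"
    unfolding F_def by (rule proots_prod_linear) simp
  have "zeros_upto G x = card {k \<in> {..<m}. \<beta> k \<le> x}"
    by (simp add: zeros_upto_def pG filter_mset_image_mset)
  also have "\<dots> \<le> card {k \<in> {..<m}. \<alpha> k \<le> x}"
    using \<beta>(1) by (intro card_mono) force+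
  also have "\<dots> = zeros_upto F x"
    by (simp add: zeros_upto_def pF filter_mset_image_mset)
  finally show ?thesis unfolding G_def F_def .
qed

section \<open>Pencils of hyperbolic polynomials\<close>

text \<open>Here \<open>D\<close> is the greatest common divisor: the coprime quotients have only simple zeros and
  interlace strictly.\<close>

lemma poly_alternating_decomposition:
  assumes P: "hyperbolic P" and R: "hyperbolic R" and deg: "degree R < degree P"
    and neg: "\<And>z. Im z > 0 \<Longrightarrow> Im (poly (cpoly R) z / poly (cpoly P) z) < 0"
  obtains D S c m \<alpha> where
    "c \<noteq> 0" "P = smult c ((\<Prod>i<m. [:- \<alpha> i, 1:]) * D)" "R = smult c (S * D)"
    "strict_mono_on {..<m} \<alpha>" "Suc (degree S) = m"
    "\<And>k. k < m \<Longrightarrow> (-1) ^ (m - 1 - k) * poly S (\<alpha> k) > 0"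
proof -
  have "gcd P R \<noteq> 0" using hyperbolic_nonzero[OF P] by simp
  then obtain P1 R1 D where PR: "P = P1 * D" "R = R1 * D" and cop: "coprime P1 R1"
    using gcd_coprime_exists[of P R] by blast
  have hyp: "hyperbolic P1" "hyperbolic R1" "hyperbolic D"
    using P R by (simp_all add: PR hyperbolic_mult_iff)
  note nz = this[THEN hyperbolic_nonzero]
  have neg1: "Im (poly (cpoly R1) z / poly (cpoly P1) z) < 0" if "Im z > 0" for z
  proof -
    have "poly (cpoly D) z \<noteq> 0"
      using hyp(3) that by (force simp: hyperbolic_def complex_is_Real_iff)
    then show ?thesis using neg[OF that] by (simp add: PR cpoly_mult)
  qed
  \<comment> \<open>Coprimality excludes common zeros, so the residue is positive at every zero of
    \<open>P1\<close>.\<close>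
  have simple: "order a P1 = 1 \<and> poly R1 a * poly (pderiv P1) a > 0" if "poly P1 a = 0" for a
    using simple_zero_of_Im_quotient_neg[OF nz(1) that _ neg1] coprime_poly_0[OF cop, of a] that by blast
  define X where "X = {x. poly P1 x = 0}"
  have "finite X" unfolding X_def using nz(1) by (rule poly_roots_finite)
  define xs where "xs = sorted_list_of_set X"
  define m where "m = length xs"
  define \<alpha> where "\<alpha> = (!) xs"
  define F where "F = (\<Prod>i<m. [:- \<alpha> i, 1:])"
  define c where "c = lead_coeff P1"
  have "c \<noteq> 0" using nz(1) by (simp add: c_def)
  have \<alpha>: "strict_mono_on {..<m} \<alpha>"
    using sorted_wrt_nth_less[OF strict_sorted_list_of_set[of X]]
    by (auto simp: \<alpha>_def m_def xs_def intro!: strict_mono_onI)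
  have bij: "bij_betw \<alpha> {..<m} X"
    unfolding \<alpha>_def m_def xs_def using \<open>finite X\<close> by (intro bij_betw_nth) auto
  have proots: "proots P1 = mset_set X"
    using nz(1) simple \<open>finite X\<close>
    by (intro multiset_eqI) (auto simp: X_def count_mset_set' order_0I)
  have "P1 = smult c (\<Prod>x\<in>#proots P1. [:- x, 1:])"
    unfolding c_def by (rule hyperbolic_factorization[OF hyp(1)])
  also have "(\<Prod>x\<in>#proots P1. [:- x, 1:]) = F"
    unfolding proots F_def using prod.reindex_bij_betw[OF bij, of "\<lambda>x. [:- x, 1:]"]
    by (simp add: prod_unfold_prod_mset)
  finally have P1: "P1 = smult c F" .
  define S where "S = smult (1 / c) R1"
  have R1: "R1 = smult c S" using \<open>c \<noteq> 0\<close> by (simp add: S_def)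
  have "degree F = m" using degree_prod_linear[of "{..<m}" \<alpha>] by (simp add: F_def)
  moreover have "degree P = Suc (degree R)"
    using degree_of_Im_quotient_neg[OF _ _ deg neg] P R by (simp add: hyperbolic_nonzero)
  ultimately have "Suc (degree S) = m"
    using nz \<open>c \<noteq> 0\<close> by (simp add: PR degree_mult_eq S_def P1)
  moreover have "(-1) ^ (m - 1 - k) * poly S (\<alpha> k) > 0" if "k < m" for k
  proof -
    define e :: real where "e = (-1) ^ (m - 1 - k)"
    have "poly P1 (\<alpha> k) = 0" using bij that by (auto simp: bij_betw_def X_def)
    \<comment> \<open>Positivity of the residue says that \<open>S\<close> and the derivative of
      \<open>F\<close> have equal signs at \<open>\<alpha> k\<close>; the sign of the latter is
      known from the ordering of the zeros.\<close>
    then have "c * c * (poly S (\<alpha> k) * poly (pderiv F) (\<alpha> k)) > 0"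
      using simple[of "\<alpha> k"] by (simp add: R1 P1 pderiv_smult mult_ac)
    then have "poly S (\<alpha> k) * poly (pderiv F) (\<alpha> k) > 0"
      using \<open>c \<noteq> 0\<close> by (simp add: zero_less_mult_iff)
    moreover have "e * e = 1" by (simp add: e_def flip: power_mult_distrib)
    then have "(e * poly S (\<alpha> k)) * (e * poly (pderiv F) (\<alpha> k)) = poly S (\<alpha> k) * poly (pderiv F) (\<alpha> k)"
      by (metis mult.assoc mult.left_commute mult_1)
    moreover have "e * poly (pderiv F) (\<alpha> k) > 0"
      using sgn_pderiv_prod_linear_at[OF \<alpha> that] by (simp only: e_def F_def)
    ultimately have "e * poly S (\<alpha> k) > 0"
      by (metis zero_less_mult_pos2)
    then show ?thesis by (simp only: e_def)
  qed
  ultimately show thesis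
    using that[where c = c and m = m and \<alpha> = \<alpha> and D = D and S = S] \<open>c \<noteq> 0\<close> \<alpha> P1 R1 PR by (simp add: F_def)
qed

text \<open>The intended instance is \<open>P = T ([:- x, 1:] * h)\<close> and
  \<open>R = T h\<close>; then \<open>P - smult u R\<close> is
  \<open>T ([:- (x + u), 1:] * h)\<close>.\<close>

locale hyperbolic_pencil =
  fixes P R :: "real poly"
  assumes P: "hyperbolic P" and R: "hyperbolic R"
    and pencil: "\<And>u. hyperbolic (P - smult u R)"
    and deg: "degree R < degree P"
begin

text \<open>The imaginary part of \<open>R / P\<close> has a constant but unknown sign. The factor
  \<open>\<epsilon>\<close> absorbs it, so that the results for negative imaginary part apply to
  \<open>smult \<epsilon> R\<close>.\<close>

lemma Im_quotient_cases:
  obtains \<epsilon> where "\<epsilon> = 1 \<or> \<epsilon> = -1"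
    "\<And>z. Im z > 0 \<Longrightarrow> Im (poly (cpoly (smult \<epsilon> R)) z / poly (cpoly P) z) < 0"
    "degree P = Suc (degree R)" "\<epsilon> * lead_coeff R / lead_coeff P > 0"
proof -
  have "\<exists>\<epsilon>. (\<epsilon> = 1 \<or> \<epsilon> = -1) \<and>
      (\<forall>z. Im z > 0 \<longrightarrow> Im (poly (cpoly (smult \<epsilon> R)) z / poly (cpoly P) z) < 0)"
    using Im_quotient_sign_pencil[OF P R pencil]
  proof
    assume "\<forall>z. Im z > 0 \<longrightarrow> Im (poly (cpoly R) z / poly (cpoly P) z) < 0"
    then show ?thesis by (intro exI[of _ 1]) auto
  next
    assume "\<forall>z. Im z > 0 \<longrightarrow> Im (poly (cpoly R) z / poly (cpoly P) z) > 0"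
    then show ?thesis by (intro exI[of _ "-1"]) (auto simp: cpoly_minus)
  qed
  then obtain \<epsilon> where \<epsilon>: "\<epsilon> = 1 \<or> \<epsilon> = -1"
    "\<And>z. Im z > 0 \<Longrightarrow> Im (poly (cpoly (smult \<epsilon> R)) z / poly (cpoly P) z) < 0" by blast
  then have "degree P = Suc (degree (smult \<epsilon> R)) \<and> lead_coeff (smult \<epsilon> R) / lead_coeff P > 0"
    using P R deg by (intro degree_of_Im_quotient_neg) (auto simp: hyperbolic_nonzero)
  moreover have "lead_coeff (smult \<epsilon> R) = \<epsilon> * lead_coeff R" "degree (smult \<epsilon> R) = degree R"
    using \<epsilon>(1) by auto
  ultimately show thesis using that[OF \<epsilon>] by metis
qed

lemma degree_eq: "degree P = Suc (degree R)"
  by (rule Im_quotient_cases)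

text \<open>A zero of the common factor \<open>D\<close> is itself a zero of \<open>P\<close>; the
  remaining zeros of \<open>R\<close> lie between the extreme \<open>\<alpha> k\<close>, which are
  zeros of \<open>P\<close>.\<close>

lemma zeros_between:
  assumes "poly R x = 0"
  obtains y z where "y \<le> x" "x \<le> z" "poly P y = 0" "poly P z = 0"
proof -
  obtain \<epsilon> where \<epsilon>: "\<epsilon> = 1 \<or> \<epsilon> = -1"
    "\<And>z. Im z > 0 \<Longrightarrow> Im (poly (cpoly (smult \<epsilon> R)) z / poly (cpoly P) z) < 0"
    "degree P = Suc (degree R)" "\<epsilon> * lead_coeff R / lead_coeff P > 0"
    by (rule Im_quotient_cases) blast
  then have "\<epsilon> \<noteq> 0" by auto
  then have \<epsilon>R: "hyperbolic (smult \<epsilon> R)" "degree (smult \<epsilon> R) < degree P"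
    using R deg by (simp_all add: hyperbolic_smult_iff)
  show thesis
  proof (rule poly_alternating_decomposition[OF P \<epsilon>R \<epsilon>(2)])
    fix D S c m \<alpha>
    assume *: "c \<noteq> 0" "P = smult c ((\<Prod>i<m. [:- \<alpha> i, 1:]) * D)" "smult \<epsilon> R = smult c (S * D)"
      "strict_mono_on {..<m} \<alpha>" "Suc (degree S) = m"
      "\<And>k. k < m \<Longrightarrow> (-1) ^ (m - 1 - k) * poly S (\<alpha> k) > 0"
    have "S \<noteq> 0" using *(3) hyperbolic_nonzero[OF \<epsilon>R(1)] by auto
    have "poly (smult c (S * D)) x = 0"
      unfolding *(3) [symmetric] using assms by simp
    then consider "poly D x = 0" | "poly S x = 0" using *(1) by auto
    then show thesis
    proof cases
      case 1
      then show thesis using that[of x x] *(2) by simp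
    next
      case 2
      have "poly P (\<alpha> k) = 0" if "k < m" for k
        using that by (auto simp: *(2) poly_prod)
      then show thesis
        using that alternating_signs_zeros_between[OF *(4,6,5) \<open>S \<noteq> 0\<close> 2] *(5) by auto
    qed
  qed
qed

text \<open>Equal signs of the leading coefficients force \<open>\<epsilon> = 1\<close>, the
  orientation in which subtracting a positive multiple of \<open>R\<close> moves zeros to the right.
  The common factor \<open>D\<close> keeps its zeros.\<close>

lemma zeros_upto_antimono:
  assumes "lead_coeff R * lead_coeff P > 0" "\<delta> \<ge> 0"
  shows "zeros_upto (P - smult \<delta> R) x \<le> zeros_upto P x"
proof (cases "\<delta> = 0")
  case False
  obtain \<epsilon> where \<epsilon>: "\<epsilon> = 1 \<or> \<epsilon> = -1"
    "\<And>z. Im z > 0 \<Longrightarrow> Im (poly (cpoly (smult \<epsilon> R)) z / poly (cpoly P) z) < 0"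
    "degree P = Suc (degree R)" "\<epsilon> * lead_coeff R / lead_coeff P > 0"
    by (rule Im_quotient_cases) blast
  have "\<epsilon> = 1"
    using \<epsilon>(1,4) assms(1) by (auto simp: zero_less_mult_iff zero_less_divide_iff divide_less_0_iff)
  with \<epsilon>(2) have neg: "\<And>z. Im z > 0 \<Longrightarrow> Im (poly (cpoly R) z / poly (cpoly P) z) < 0" by simp
  show ?thesis
  proof (rule poly_alternating_decomposition[OF P R deg neg])
    fix D S c m \<alpha>
    assume *: "c \<noteq> 0" "P = smult c ((\<Prod>i<m. [:- \<alpha> i, 1:]) * D)" "R = smult c (S * D)"
      "strict_mono_on {..<m} \<alpha>" "Suc (degree S) = m"
      "\<And>k. k < m \<Longrightarrow> (-1) ^ (m - 1 - k) * poly S (\<alpha> k) > 0"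
    define F where "F = (\<Prod>i<m. [:- \<alpha> i, 1:])"
    have eq: "P - smult \<delta> R = smult c ((F - smult \<delta> S) * D)"
      by (simp add: *(2,3) F_def [symmetric] algebra_simps smult_diff_right)
    have "P - smult \<delta> R \<noteq> 0" using pencil hyperbolic_nonzero by blast
    then have "F - smult \<delta> S \<noteq> 0" "D \<noteq> 0" unfolding eq by auto
    moreover have "F \<noteq> 0" by (simp add: F_def)
    moreover have "zeros_upto (F - smult \<delta> S) x \<le> zeros_upto F x"
      unfolding F_def using * assms(2) False by (intro alternating_signs_shift_zeros) auto
    moreover have "zeros_upto P x = zeros_upto F x + zeros_upto D x"
      unfolding *(2) F_def [symmetric] zeros_upto_smult[OF *(1)]
      using calculation by (intro zeros_upto_mult) auto
    moreover have "zeros_upto (P - smult \<delta> R) x = zeros_upto (F - smult \<delta> S) x + zeros_upto D x"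
      unfolding eq zeros_upto_smult[OF *(1)] using calculation by (intro zeros_upto_mult) auto
    ultimately show ?thesis by simp
  qed
qed simp

end

section \<open>Differential operators preserving hyperbolicity\<close>

text \<open>The factor that \<open>j\<close> differentiations bring out of the \<open>k\<close>-th
  power of a monic linear polynomial.\<close>

definition falling :: "nat \<Rightarrow> nat \<Rightarrow> real" where
  "falling k j = (\<Prod>i<j. real k - real i)"

lemma falling_0 [simp]: "falling k 0 = 1"
  by (simp add: falling_def)

lemma falling_Suc: "falling k (Suc j) = falling k j * (real k - real j)"
  by (simp add: falling_def)

lemma falling_eq_0: "k < j \<Longrightarrow> falling k j = 0"
  unfolding falling_def by (rule prod_zero) auto

lemma falling_pos: "j \<le> k \<Longrightarrow> falling k j > 0"
  unfolding falling_def by (intro prod_pos) auto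

lemma falling_ratio_tendsto_0:
  assumes "j < m"
  shows "(\<lambda>k. falling k j / falling k m) \<longlonglongrightarrow> 0"
  using assms
proof (induction m)
  case (Suc m)
  have "filterlim (\<lambda>k. real k - real m) at_top sequentially"
    using filterlim_tendsto_add_at_top[OF tendsto_const[of "- real m"] filterlim_real_sequentially]
    by simp
  then have inv: "(\<lambda>k. 1 / (real k - real m)) \<longlonglongrightarrow> 0"
    by (intro tendsto_divide_0[OF tendsto_const] filterlim_at_top_imp_at_infinity)
  \<comment> \<open>Any finite limit suffices, since the new factor tends to 0. For
    \<open>j = m\<close> the ratio is 1 only once \<open>k \<ge> m\<close>; before that it is
    \<open>0 / 0 = 0\<close>.\<close>
  have "\<exists>l. (\<lambda>k. falling k j / falling k m) \<longlonglongrightarrow> l"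
  proof (cases "j = m")
    case True
    have "eventually (\<lambda>k. falling k j / falling k m = 1) sequentially"
      using eventually_ge_at_top[of m] proof eventually_elim
      case (elim k)
      then show ?case using falling_pos[of m k] True by simp
    qed
    then show ?thesis by (intro exI[of _ 1] tendsto_eventually)
  qed (use Suc in auto)
  then obtain l where "(\<lambda>k. falling k j / falling k m) \<longlonglongrightarrow> l" by blast
  from tendsto_mult[OF this inv] show ?case by (simp add: falling_Suc)
qed simp

lemma higher_pderiv_linear_power:
  "(pderiv ^^ j) ([:- x, 1 :: real:] ^ k) = smult (falling k j) ([:- x, 1:] ^ (k - j))"
proof (induction j)
  case (Suc j)
  show ?case
  proof (cases "j < k")
    case True
    then obtain i where "k - j = Suc i" "k - Suc j = i" "real k - real j = 1 + real i"
      by (metis Suc_diff_Suc Suc_diff_eq_diff_pred of_nat_Suc of_nat_diff less_imp_le add.commute)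
    then show ?thesis
      using Suc by (simp add: pderiv_smult pderiv_power_Suc falling_Suc pderiv_pCons mult_ac del: power_Suc)
  next
    case False
    then show ?thesis using Suc by (simp add: falling_eq_0 pderiv_smult)
  qed
qed simp

text \<open>Near infinity the comparison of degrees bounds the quotient, and on the remaining
  compact part of \<open>X\<close> continuity does. This will control the lower-order terms of
  \<open>T\<close> uniformly on a closed half-line.\<close>

lemma poly_quotient_bounded_on:
  fixes p q :: "real poly"
  assumes "degree p \<le> degree q" "q \<noteq> 0" "closed X" "\<And>y. y \<in> X \<Longrightarrow> poly q y \<noteq> 0"
  shows "\<exists>C. \<forall>y\<in>X. \<bar>poly p y / poly q y\<bar> \<le> C"
proof -
  define l where "l = \<bar>lead_coeff q\<bar> / 2"
  have l: "l > 0" using assms(2) by (simp add: l_def)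
  have "((\<lambda>y. \<bar>poly q y / y ^ degree q\<bar>) \<longlongrightarrow> \<bar>lead_coeff q\<bar>) at_infinity"
    by (intro tendsto_rabs poly_divide_tendsto_aux)
  moreover have "l < \<bar>lead_coeff q\<bar>" using l by (simp add: l_def)
  ultimately have "eventually (\<lambda>y. l < \<bar>poly q y / y ^ degree q\<bar>) at_infinity"
    by (rule order_tendstoD(1))
  then obtain b where b: "\<And>y. b \<le> \<bar>y\<bar> \<Longrightarrow> l < \<bar>poly q y / y ^ degree q\<bar>"
    unfolding eventually_at_infinity by auto
  define A where "A = (\<Sum>i\<le>degree p. \<bar>coeff p i\<bar>)"
  have far: "\<bar>poly p y / poly q y\<bar> \<le> A / l" if y: "\<bar>y\<bar> \<ge> max 1 b" for y
  proof -
    have "\<bar>poly p y\<bar> \<le> (\<Sum>i\<le>degree p. \<bar>coeff p i * y ^ i\<bar>)"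
      unfolding poly_altdef by (rule sum_abs)
    also have "\<dots> \<le> (\<Sum>i\<le>degree p. \<bar>coeff p i\<bar> * \<bar>y\<bar> ^ degree q)"
      unfolding abs_mult power_abs
      using y assms(1) by (intro sum_mono mult_left_mono power_increasing) auto
    finally have "\<bar>poly p y\<bar> \<le> A * \<bar>y\<bar> ^ degree q" by (simp add: A_def sum_distrib_right)
    moreover have "l * \<bar>y\<bar> ^ degree q \<le> \<bar>poly q y\<bar>"
      using b[of y] y by (simp add: abs_divide power_abs field_simps)
    moreover have "0 < \<bar>y\<bar> ^ degree q" using y by (intro zero_less_power) auto
    ultimately have "\<bar>poly p y\<bar> / \<bar>poly q y\<bar> \<le> (A * \<bar>y\<bar> ^ degree q) / (l * \<bar>y\<bar> ^ degree q)"
      using l by (intro frac_le) (auto simp: A_def intro!: mult_nonneg_nonneg sum_nonneg)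
    then show ?thesis using \<open>0 < \<bar>y\<bar> ^ degree q\<close> by (auto simp: abs_divide split: if_splits)
  qed
  have "compact (X \<inter> cball 0 (max 1 b))"
    using assms(3) by (intro closed_Int_compact) auto
  then have "compact ((\<lambda>y. poly p y / poly q y) ` (X \<inter> cball 0 (max 1 b)))"
    using assms(4) by (intro compact_continuous_image continuous_intros) auto
  then obtain C where "\<forall>w\<in>(\<lambda>y. poly p y / poly q y) ` (X \<inter> cball 0 (max 1 b)). norm w \<le> C"
    using compact_imp_bounded bounded_iff by blast
  then have C: "\<And>y. y \<in> X \<inter> cball 0 (max 1 b) \<Longrightarrow> \<bar>poly p y / poly q y\<bar> \<le> C"
    by simp
  have "\<bar>poly p y / poly q y\<bar> \<le> max (A / l) C" if "y \<in> X" for y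
    using far[of y] C[of y] that by (cases "\<bar>y\<bar> \<ge> max 1 b") (auto simp: dist_norm le_max_iff_disj)
  then show ?thesis by blast
qed

lemma higher_pderiv_eq_0: "degree p < k \<Longrightarrow> (pderiv ^^ k) p = 0" for p :: "real poly"
proof (induction k)
  case (Suc k)
  then show ?case
    using degree_higher_pderiv[of k p] by (simp add: pderiv_eq_0_iff)
qed simp

lemma diff_op_add: "diff_op N Q (p + q) = diff_op N Q p + diff_op N Q q"
  by (simp add: diff_op_def higher_pderiv_add algebra_simps sum.distrib)

lemma diff_op_smult: "diff_op N Q (smult c p) = smult c (diff_op N Q p)"
proof -
  have "smult c (diff_op N Q p) = [:c:] * diff_op N Q p" by simp
  then show ?thesis
    by (simp add: diff_op_def higher_pderiv_smult sum_distrib_left del: mult_pCons_left) simp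
qed

lemma diff_op_0: "diff_op N Q 0 = 0"
  using diff_op_smult[of N Q 0 0] by simp

lemma diff_op_diff: "diff_op N Q (p - q) = diff_op N Q p - diff_op N Q q"
  using diff_op_add[of N Q p "smult (-1) q"] unfolding diff_op_smult by simp

lemma diff_op_sum: "diff_op N Q (\<Sum>i\<in>I. g i) = (\<Sum>i\<in>I. diff_op N Q (g i))"
  by (induction I rule: infinite_finite_induct) (simp_all add: diff_op_0 diff_op_add)

text \<open>By \<open>degQ\<close> the Fuchs index is at most \<open>r\<close>; by
  \<open>degQN\<close> it is attained at \<open>k = N\<close>, which is non-degeneracy.\<close>

locale hyperbolicity_preserver =
  fixes N r :: nat and Q :: "nat \<Rightarrow> real poly"
  assumes QN: "Q N \<noteq> 0" and degQN: "degree (Q N) = N + r"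
    and degQ: "\<And>k. k \<le> N \<Longrightarrow> degree (Q k) \<le> k + r"
    and pres: "preserves_hyperbolicity (diff_op N Q)"
begin

section \<open>Action on degrees and leading coefficients\<close>

abbreviation T :: "real poly \<Rightarrow> real poly" where "T \<equiv> diff_op N Q"

text \<open>\<open>T\<close> raises degrees by at most \<open>r\<close>; \<open>lam k\<close> is the
  factor from the leading coefficient of a polynomial of degree \<open>k\<close> to the coefficient
  of index \<open>k + r\<close> of its image. A priori it may vanish.\<close>

definition lam :: "nat \<Rightarrow> real" where "lam k = coeff (T (monom 1 k)) (k + r)"

lemma hyperbolic_T: "hyperbolic f \<Longrightarrow> T f \<noteq> 0 \<Longrightarrow> hyperbolic (T f)"
  using pres by (auto simp: preserves_hyperbolicity_def)

lemma degree_T_le: "degree (T f) \<le> degree f + r"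
  unfolding diff_op_def
proof (rule degree_sum_le)
  fix k assume "k \<in> {..N}"
  then show "degree (Q k * (pderiv ^^ k) f) \<le> degree f + r"
    using degree_mult_le[of "Q k" "(pderiv ^^ k) f"] degQ[of k] degree_higher_pderiv[of k f]
      higher_pderiv_eq_0[of f k] by (cases "degree f < k") auto
qed simp

lemma coeff_T:
  assumes "degree f \<le> k"
  shows "coeff (T f) (k + r) = coeff f k * lam k"
proof -
  have "T f = T (\<Sum>i\<le>k. smult (coeff f i) (monom 1 i))"
    using poly_as_sum_of_monoms'[OF assms] by (simp add: smult_monom)
  also have "coeff \<dots> (k + r) = (\<Sum>i\<le>k. coeff f i * coeff (T (monom 1 i)) (k + r))"
    by (simp add: diff_op_sum diff_op_smult coeff_sum)
  also have "\<dots> = (\<Sum>i\<in>{k}. coeff f i * coeff (T (monom 1 i)) (k + r))"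
  proof (rule sum.mono_neutral_right)
    show "\<forall>i\<in>{..k} - {k}. coeff f i * coeff (T (monom 1 i)) (k + r) = 0"
    proof
      fix i assume "i \<in> {..k} - {k}"
      then have "degree (T (monom 1 i)) < k + r"
        using degree_T_le[of "monom 1 i"] by (simp add: degree_monom_eq)
      then show "coeff f i * coeff (T (monom 1 i)) (k + r) = 0"
        by (simp add: coeff_eq_0)
    qed
  qed auto
  finally show ?thesis by (simp add: lam_def)
qed

lemma degree_T:
  assumes "f \<noteq> 0" "lam (degree f) \<noteq> 0"
  shows "degree (T f) = degree f + r" "lead_coeff (T f) = lead_coeff f * lam (degree f)" "T f \<noteq> 0"
proof -
  have c: "coeff (T f) (degree f + r) = lead_coeff f * lam (degree f)" by (rule coeff_T) simp
  then show d: "degree (T f) = degree f + r"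
    using assms degree_T_le[of f] by (intro antisym le_degree) auto
  show "lead_coeff (T f) = lead_coeff f * lam (degree f)" unfolding d by (rule c)
  with assms show "T f \<noteq> 0" by auto
qed

text \<open>In \<open>Q j\<close> only the coefficient of index \<open>j + r\<close> contributes at
  index \<open>k + r\<close>. This writes \<open>lam\<close> in the basis of falling factorials,
  with top term \<open>falling k N * lead_coeff (Q N)\<close>.\<close>

lemma lam_eq: "lam k = (\<Sum>j\<le>N. falling k j * coeff (Q j) (j + r))"
proof -
  have m: "monom 1 k = [:- 0, 1 :: real:] ^ k" by (simp add: monom_altdef)
  have "coeff (Q j * (pderiv ^^ j) (monom 1 k)) (k + r) = falling k j * coeff (Q j) (j + r)" for j
  proof (cases "j \<le> k")
    case True
    have "(pderiv ^^ j) (monom 1 k) = smult (falling k j) (monom 1 (k - j))"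
      unfolding m higher_pderiv_linear_power by (simp add: monom_altdef)
    then show ?thesis
      using True coeff_monom_mult[of 1 "k - j" "Q j" "k + r"]
      by (simp add: mult.commute[of "Q j"] add.commute)
  qed (unfold m higher_pderiv_linear_power, simp add: falling_eq_0)
  then show ?thesis by (simp add: lam_def diff_op_def coeff_sum)
qed

text \<open>Divided by \<open>falling k N\<close>, \<open>lam k\<close> tends to
  \<open>lead_coeff (Q N)\<close>.\<close>

lemma lam_eventually_sign: "eventually (\<lambda>k. lam k * lead_coeff (Q N) > 0) sequentially"
proof -
  have "(\<lambda>k. \<Sum>j<N. falling k j / falling k N * coeff (Q j) (j + r)) \<longlonglongrightarrow> (\<Sum>j<N. 0 * coeff (Q j) (j + r))"
    by (intro tendsto_intros falling_ratio_tendsto_0) auto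
  then have "(\<lambda>k. ((\<Sum>j<N. falling k j / falling k N * coeff (Q j) (j + r)) + lead_coeff (Q N)) * lead_coeff (Q N))
      \<longlonglongrightarrow> (0 + lead_coeff (Q N)) * lead_coeff (Q N)"
    by (intro tendsto_intros) simp
  moreover have "(0 + lead_coeff (Q N)) * lead_coeff (Q N) > 0"
    by (metis QN add_0 leading_coeff_neq_0 not_real_square_gt_zero)
  ultimately have "eventually (\<lambda>k. 0 < ((\<Sum>j<N. falling k j / falling k N * coeff (Q j) (j + r)) + lead_coeff (Q N)) * lead_coeff (Q N)) sequentially"
    by (rule order_tendstoD(1))
  then show ?thesis
    using eventually_ge_at_top[of N]
  proof eventually_elim
    case (elim k)
    define p where "p = falling k N"
    have "p > 0" unfolding p_def using elim(2) by (rule falling_pos)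
    have "lam k = (\<Sum>j<N. falling k j * coeff (Q j) (j + r)) + p * lead_coeff (Q N)"
      unfolding lam_eq p_def degQN by (simp add: lessThan_Suc_atMost [symmetric])
    also have "\<dots> = p * ((\<Sum>j<N. falling k j / p * coeff (Q j) (j + r)) + lead_coeff (Q N))"
      using \<open>p > 0\<close> by (simp add: distrib_left sum_distrib_left)
    finally have "lam k = p * ((\<Sum>j<N. falling k j / p * coeff (Q j) (j + r)) + lead_coeff (Q N))" .
    with elim(1) \<open>p > 0\<close> show ?case by (simp add: p_def mult.assoc)
  qed
qed

section \<open>Non-vanishing and sign of the leading factors\<close>

lemma pencil_T:
  assumes h: "hyperbolic h" and Th: "T h \<noteq> 0" and lam: "lam (Suc (degree h)) \<noteq> 0"
  shows "hyperbolic_pencil (T ([:- x, 1:] * h)) (T h)"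
proof -
  have h0: "h \<noteq> 0" using h by (rule hyperbolic_nonzero)
  have deg: "degree ([:- y, 1:] * h) = Suc (degree h)" for y
    using h0 by (subst degree_mult_eq) auto
  \<comment> \<open>The assumption on \<open>lam\<close> rules out a zero image for every
    \<open>y\<close>, so each member of the pencil is hyperbolic, and it makes the degree exceed
    that of \<open>T h\<close>.\<close>
  have T: "T ([:- y, 1:] * h) \<noteq> 0" "degree (T ([:- y, 1:] * h)) = Suc (degree h) + r" for y
    using degree_T[of "[:- y, 1:] * h"] h0 lam unfolding deg by (simp_all del: mult_pCons_left)
  have hyp: "hyperbolic (T ([:- y, 1:] * h))" for y
    using T(1) h by (intro hyperbolic_T) (simp_all add: hyperbolic_mult_iff hyperbolic_linear del: mult_pCons_left)
  show ?thesis
  proof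
    fix u
    have "T ([:- x, 1:] * h) - smult u (T h) = T ([:- (x + u), 1:] * h)"
      unfolding diff_op_smult [symmetric] diff_op_diff [symmetric]
      by (rule arg_cong[of _ _ T]) (simp add: smult_diff_left)
    then show "hyperbolic (T ([:- x, 1:] * h) - smult u (T h))" using hyp[of "x + u"] by (simp only:)
    show "degree (T h) < degree (T ([:- x, 1:] * h))"
      unfolding T(2) using degree_T_le[of h] by simp
  qed (use hyp hyperbolic_T[OF h Th] in simp_all)
qed

text \<open>If \<open>T h \<noteq> 0\<close> with \<open>degree h = k\<close>, the pencil forces
  \<open>degree (T h) = k + r\<close>, although the coefficient of that index is 0. Smaller degrees
  follow by downward induction.\<close>

lemma T_eq_0_if_lam_eq_0:
  assumes "lam k = 0" "lam (Suc k) \<noteq> 0" "hyperbolic h" "degree h \<le> k"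
  shows "T h = 0"
  using assms(3,4)
proof (induction "k - degree h" arbitrary: h)
  case 0
  then have k: "degree h = k" by simp
  show ?case
  proof (rule ccontr)
    assume "T h \<noteq> 0"
    then interpret hyperbolic_pencil "T ([:- 0, 1:] * h)" "T h"
      using 0 assms k by (intro pencil_T) auto
    have h0: "h \<noteq> 0" using 0 by (simp add: hyperbolic_nonzero)
    have deg: "degree ([:- 0, 1:] * h) = Suc k"
      using h0 k by (subst degree_mult_eq) auto
    have "degree (T ([:- 0, 1:] * h)) = Suc k + r"
      using degree_T(1)[of "[:- 0, 1:] * h"] h0 assms unfolding deg by (simp del: mult_pCons_left)
    then have "degree (T h) = k + r" using degree_eq by simp
    moreover have "coeff (T h) (k + r) = 0" using coeff_T[of h k] k assms by simp
    ultimately have "lead_coeff (T h) = 0" by simp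
    with \<open>T h \<noteq> 0\<close> show False by simp
  qed
next
  case (Suc i)
  have h0: "h \<noteq> 0" using Suc by (simp add: hyperbolic_nonzero)
  have "T ([:- y, 1:] * h) = 0" for y
  proof -
    have "degree ([:- y, 1:] * h) = Suc (degree h)"
      using h0 by (subst degree_mult_eq) auto
    then show ?thesis
      using Suc by (intro Suc.hyps(1)) (simp_all add: hyperbolic_mult_iff hyperbolic_linear del: mult_pCons_left)
  qed
  \<comment> \<open>The difference of these two products is \<open>h\<close> itself.\<close>
  then have "T ([:- 0, 1:] * h - [:- 1, 1:] * h) = 0"
    unfolding diff_op_diff by (simp only: diff_self)
  then show ?case by simp
qed

text \<open>A zero of \<open>lam\<close> at \<open>k\<close> would propagate to all larger
  arguments, because \<open>T h \<noteq> 0\<close>; this contradicts the eventual sign of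
  \<open>lam\<close>.\<close>

lemma lam_nonzero:
  assumes "hyperbolic h" "T h \<noteq> 0" "degree h \<le> k"
  shows "lam k \<noteq> 0"
proof
  assume "lam k = 0"
  have "lam (k + i) = 0" for i
  proof (induction i)
    case (Suc i)
    then show ?case using T_eq_0_if_lam_eq_0[of "k + i" h] assms by auto
  qed (use \<open>lam k = 0\<close> in simp)
  then have "\<not> lam i * lead_coeff (Q N) > 0" if "i \<ge> k" for i
    using le_Suc_ex[OF that] by auto
  then show False
    using eventually_happens[OF eventually_conj[OF lam_eventually_sign eventually_ge_at_top[of k]]] by auto
qed

text \<open>The inequality \<open>hyperbolic_newton\<close> for the image of
  \<open>z ^ k * (z ^ 2 - s)\<close> reads
  \<open>2 * lam (k + 2) * (C2 - s * lam k) \<le> C1 ^ 2\<close> for all \<open>s \<ge> 0\<close>;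
  were the product negative, the left side would be unbounded in \<open>s\<close>.\<close>

lemma lam_mult_lam_Suc_Suc_nonneg: "lam k * lam (k + 2) \<ge> 0"
proof (rule ccontr)
  assume "\<not> ?thesis"
  then have neg: "lam k * lam (k + 2) < 0" by simp
  then have lam: "lam (k + 2) \<noteq> 0" by auto
  define C1 where "C1 = coeff (T (monom 1 (k + 2))) (k + r + 1)"
  define C2 where "C2 = coeff (T (monom 1 (k + 2))) (k + r)"
  have newton: "2 * lam (k + 2) * (C2 - s * lam k) \<le> C1\<^sup>2" if "s \<ge> 0" for s
  proof -
    define f where "f = monom 1 k * ([:- sqrt s, 1:] * [:- (- sqrt s), 1:])"
    have "hyperbolic (monom 1 k)"
      using hyperbolic_power[OF hyperbolic_linear[of 0]] by (simp add: monom_altdef)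
    then have "hyperbolic f"
      by (simp add: f_def hyperbolic_mult_iff hyperbolic_linear del: mult_pCons_left mult_pCons_right minus_minus)
    have f: "f = monom 1 (k + 2) - smult s (monom 1 k)"
      using that by (simp add: f_def algebra_simps monom_altdef)
    have "degree f = k + 2" unfolding f_def
      by (subst degree_mult_eq | simp add: degree_monom_eq del: mult_pCons_left mult_pCons_right)+
    have Tf: "T f = T (monom 1 (k + 2)) - smult s (T (monom 1 k))"
      by (simp add: f diff_op_diff diff_op_smult)
    have deg: "degree (T f) = k + r + 2" "T f \<noteq> 0"
      using degree_T[of f] lam \<open>degree f = k + 2\<close> \<open>hyperbolic f\<close> hyperbolic_nonzero[of f] by simp_all
    have "2 * coeff (T f) (k + r + 2) * coeff (T f) (k + r) \<le> coeff (T f) (k + r + 1) ^ 2"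
      using hyperbolic_T[OF \<open>hyperbolic f\<close>] deg by (intro hyperbolic_newton) auto
    moreover have "degree (T (monom 1 k)) \<le> k + r"
      using degree_T_le[of "monom 1 k"] by (simp add: degree_monom_eq)
    ultimately show ?thesis
      by (simp add: Tf C1_def C2_def lam_def coeff_eq_0 add_ac)
  qed
  define t where "t = - (lam k * lam (k + 2))"
  have "t > 0" using neg by (simp add: t_def)
  have "2 * lam (k + 2) * C2 + 2 * s * t \<le> C1\<^sup>2" if "s \<ge> 0" for s
    using newton[OF that] by (simp add: t_def algebra_simps)
  \<comment> \<open>This \<open>s\<close> is chosen so that \<open>2 * s * t\<close> outweighs the
    remaining terms.\<close>
  from this[of "(C1\<^sup>2 + \<bar>2 * lam (k + 2) * C2\<bar> + 1) / t"]
  have "2 * lam (k + 2) * C2 + 2 * (C1\<^sup>2 + \<bar>2 * lam (k + 2) * C2\<bar> + 1) \<le> C1\<^sup>2"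
    using \<open>t > 0\<close> by simp
  then show False by (smt (verit) zero_le_power2)
qed

text \<open>The sign of \<open>lam k\<close> depends only on the parity of \<open>k\<close>, and it is constant for large \<open>k\<close>,
  where \<open>lam k\<close> behaves like \<open>lead_coeff (Q N) * k ^ N\<close>.\<close>

lemma lam_same_sign:
  assumes "hyperbolic h" "T h \<noteq> 0" "degree h \<le> k"
  shows "lam k * lam (Suc k) > 0"
proof (rule ccontr)
  assume neg: "\<not> ?thesis"
  have nz: "lam j \<noteq> 0" if "j \<ge> k" for j
    using lam_nonzero[OF assms(1,2)] assms(3) that by auto
  have alt: "lam (k + i) * lam (Suc (k + i)) < 0" for i
  proof (induction i)
    case 0
    then show ?case using neg nz[of k] nz[of "Suc k"] by (simp add: not_less le_less)
  next
    case (Suc i)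
    moreover have "lam (k + i) * lam (Suc (Suc (k + i))) \<ge> 0"
      using lam_mult_lam_Suc_Suc_nonneg[of "k + i"] by simp
    ultimately show ?case
      using nz[of "Suc (Suc (k + i))"] by (auto simp: mult_less_0_iff zero_le_mult_iff)
  qed
  have "eventually (\<lambda>j. lam (Suc j) * lead_coeff (Q N) > 0) sequentially"
    using lam_eventually_sign by (rule eventually_all_ge_at_top[THEN eventually_mono]) auto
  then have "eventually (\<lambda>j. False) sequentially"
    using lam_eventually_sign eventually_ge_at_top[of k]
  proof eventually_elim
    case (elim j)
    then obtain i where "j = k + i" using le_Suc_ex by blast
    then show ?case
      using alt[of i] elim(1,2) by (auto simp: mult_less_0_iff zero_less_mult_iff)
  qed
  then show False by simp
qed

section \<open>Monotonicity of \<open>T\<close> in the zeros\<close>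

lemma zeros_upto_T_move_zero:
  assumes h: "hyperbolic h" and "s \<le> t"
  shows "zeros_upto (T ([:- t, 1:] * h)) x \<le> zeros_upto (T ([:- s, 1:] * h)) x"
proof -
  \<comment> \<open>Moving one zero from \<open>s\<close> to \<open>t\<close> is a step by
    \<open>t - s \<ge> 0\<close> in the pencil with \<open>R = T h\<close>.\<close>
  have eq: "T ([:- t, 1:] * h) = T ([:- s, 1:] * h) - smult (t - s) (T h)"
    unfolding diff_op_smult [symmetric] diff_op_diff [symmetric]
    by (rule arg_cong[of _ _ T]) (simp add: smult_diff_left)
  show ?thesis
  proof (cases "T h = 0")
    case True
    then show ?thesis unfolding eq by simp
  next
    case False
    have h0: "h \<noteq> 0" using h by (simp add: hyperbolic_nonzero)
    define d where "d = degree h"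
    have lam: "lam d \<noteq> 0" "lam (Suc d) \<noteq> 0" "lam d * lam (Suc d) > 0"
      using lam_nonzero[OF h False] lam_same_sign[OF h False] by (auto simp: d_def)
    interpret hyperbolic_pencil "T ([:- s, 1:] * h)" "T h"
      using h False lam by (intro pencil_T) (auto simp: d_def)
    have deg: "degree ([:- s, 1:] * h) = Suc d"
      using h0 unfolding d_def by (subst degree_mult_eq) auto
    have "lead_coeff (T ([:- s, 1:] * h)) = lead_coeff ([:- s, 1:] * h) * lam (Suc d)"
      using degree_T(2)[of "[:- s, 1:] * h"] h0 lam unfolding deg by (simp del: mult_pCons_left)
    also have "lead_coeff ([:- s, 1:] * h) = lead_coeff h"
      unfolding lead_coeff_mult by simp
    \<comment> \<open>\<open>lam d\<close> and \<open>lam (Suc d)\<close> have equal signs, hence so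
      do the two leading coefficients, which is the condition for motion to the right.\<close>
    finally have "lead_coeff (T h) * lead_coeff (T ([:- s, 1:] * h)) = lead_coeff h ^ 2 * (lam d * lam (Suc d))"
      using degree_T(2)[of h] h0 lam by (simp add: d_def power2_eq_square)
    also have "\<dots> > 0" using lam h0 by simp
    finally show ?thesis
      unfolding eq using \<open>s \<le> t\<close> by (intro zeros_upto_antimono) auto
  qed
qed

lemma zeros_upto_T_prod_antimono:
  assumes "finite I" "\<And>i. i \<in> I \<Longrightarrow> \<phi> i \<le> \<psi> i"
  shows "zeros_upto (T (\<Prod>i\<in>I. [:- \<psi> i, 1:])) x \<le> zeros_upto (T (\<Prod>i\<in>I. [:- \<phi> i, 1:])) x"
proof -
  \<comment> \<open>The extra factor \<open>g\<close> strengthens the induction: it carries the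
    linear factors that stay fixed while the others are moved.\<close>
  have "zeros_upto (T (g * (\<Prod>i\<in>I. [:- \<psi> i, 1:]))) x \<le> zeros_upto (T (g * (\<Prod>i\<in>I. [:- \<phi> i, 1:]))) x"
    if "hyperbolic g" for g
    using assms that
  proof (induction I arbitrary: g)
    case (insert i I)
    let ?F = "\<lambda>\<phi>. \<Prod>i\<in>I. [:- \<phi> i, 1:]"
    have "zeros_upto (T (g * (\<Prod>i\<in>insert i I. [:- \<psi> i, 1:]))) x = zeros_upto (T (([:- \<psi> i, 1:] * g) * ?F \<psi>)) x"
      using insert.hyps by (simp add: mult_ac del: mult_pCons_left mult_pCons_right)
    also have "\<dots> \<le> zeros_upto (T (([:- \<psi> i, 1:] * g) * ?F \<phi>)) x"
      using insert by (intro insert.IH) (auto simp: hyperbolic_mult_iff hyperbolic_linear simp del: mult_pCons_left)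
    also have "\<dots> = zeros_upto (T ([:- \<psi> i, 1:] * (g * ?F \<phi>))) x"
      by (simp only: mult.assoc)
    also have "\<dots> \<le> zeros_upto (T ([:- \<phi> i, 1:] * (g * ?F \<phi>))) x"
      using insert.prems
      by (intro zeros_upto_T_move_zero) (auto simp: hyperbolic_mult_iff hyperbolic_prod_linear)
    also have "\<dots> = zeros_upto (T (g * (\<Prod>i\<in>insert i I. [:- \<phi> i, 1:]))) x"
      using insert.hyps by (simp add: mult_ac del: mult_pCons_left mult_pCons_right)
    finally show ?case .
  qed simp
  from this[of 1] show ?thesis by (simp add: hyperbolic_1)
qed

section \<open>Extreme zeros of images of powers of a linear polynomial\<close>

lemma T_zeros_between:
  assumes h: "hyperbolic h" and Th: "T h \<noteq> 0" and "poly (T h) \<zeta> = 0"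
  obtains y z where "y \<le> \<zeta>" "\<zeta> \<le> z" "poly (T ([:- x, 1:] * h)) y = 0" "poly (T ([:- x, 1:] * h)) z = 0"
proof -
  interpret hyperbolic_pencil "T ([:- x, 1:] * h)" "T h"
    using lam_nonzero[OF h Th] by (intro pencil_T h Th) auto
  from zeros_between[OF assms(3)] that show thesis by blast
qed

lemma T_nonzero_of_degree_le:
  assumes "hyperbolic h" "T h \<noteq> 0" "p \<noteq> 0" "degree h \<le> degree p"
  shows "T p \<noteq> 0"
  using lam_nonzero[OF assms(1,2,4)] degree_T(3) assms(3) by blast

text \<open>Each further factor \<open>[:- x, 1:]\<close> can only widen the range of the zeros of
  the image. So the zeros for exponent \<open>n\<close> are controlled by those for arbitrarily
  large exponents.\<close>

lemma T_linear_power_zeros_between: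
  assumes "T ([:- x, 1:] ^ n) \<noteq> 0" "poly (T ([:- x, 1:] ^ n)) \<zeta> = 0" "n \<le> M"
  shows "\<exists>y z. y \<le> \<zeta> \<and> \<zeta> \<le> z \<and> poly (T ([:- x, 1:] ^ M)) y = 0 \<and> poly (T ([:- x, 1:] ^ M)) z = 0"
  using assms(3)
proof (induction M rule: dec_induct)
  case base
  then show ?case using assms(2) by auto
next
  case (step M)
  then obtain y z where yz: "y \<le> \<zeta>" "\<zeta> \<le> z" "poly (T ([:- x, 1:] ^ M)) y = 0" "poly (T ([:- x, 1:] ^ M)) z = 0"
    by blast
  have hyp: "hyperbolic ([:- x, 1:] ^ k)" for k
    by (intro hyperbolic_power hyperbolic_linear)
  have "T ([:- x, 1:] ^ M) \<noteq> 0"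
    using step.hyps by (intro T_nonzero_of_degree_le[OF hyp assms(1)]) (auto simp: degree_linear_power)
  note between = T_zeros_between[OF hyp this, of _ x]
  obtain y' where "y' \<le> y" "poly (T ([:- x, 1:] * [:- x, 1:] ^ M)) y' = 0"
    using between[OF yz(3)] by metis
  moreover obtain z' where "z \<le> z'" "poly (T ([:- x, 1:] * [:- x, 1:] ^ M)) z' = 0"
    using between[OF yz(4)] by metis
  ultimately show ?case
    using yz(1,2) unfolding power_Suc by (meson order.trans)
qed

lemma poly_T_linear_power:
  "poly (T ([:- x, 1:] ^ n)) y = (\<Sum>k\<le>N. falling n k * poly (Q k) y * (y - x) ^ (n - k))"
  by (simp add: diff_op_def higher_pderiv_linear_power poly_sum mult_ac)

text \<open>As \<open>M\<close> grows, the term \<open>k = N\<close> dominates, so that away from \<open>x\<close> the zeros of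
  \<open>T ([:- x, 1:] ^ M)\<close> tend to those of \<open>Q N\<close>.\<close>

lemma T_linear_power_eventually_nonzero:
  assumes "closed X" "x \<notin> X" and QNX: "\<And>y. y \<in> X \<Longrightarrow> poly (Q N) y \<noteq> 0"
  shows "eventually (\<lambda>M. \<forall>y\<in>X. poly (T ([:- x, 1:] ^ M)) y \<noteq> 0) sequentially"
proof -
  \<comment> \<open>Up to the ratio of falling factorials, these are the terms \<open>k < N\<close>
    divided by the term \<open>k = N\<close>; the numerators have degree at most
    \<open>N + r\<close>, the degree of \<open>Q N\<close>.\<close>
  have "\<exists>C. \<forall>y\<in>X. \<bar>poly (Q k * [:- x, 1:] ^ (N - k)) y / poly (Q N) y\<bar> \<le> C" if "k < N" for k
  proof (rule poly_quotient_bounded_on)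
    show "degree (Q k * [:- x, 1:] ^ (N - k)) \<le> degree (Q N)"
      using degree_mult_le[of "Q k" "[:- x, 1:] ^ (N - k)"] degQ[of k] degQN that
      by (simp add: degree_linear_power)
  qed (use QN assms in auto)
  then obtain C where C: "\<And>k y. k < N \<Longrightarrow> y \<in> X \<Longrightarrow> \<bar>poly (Q k * [:- x, 1:] ^ (N - k)) y / poly (Q N) y\<bar> \<le> C k"
    by metis
  have "(\<lambda>M. \<Sum>k<N. \<bar>falling M k / falling M N\<bar> * C k) \<longlonglongrightarrow> (\<Sum>k<N. \<bar>0\<bar> * C k)"
    by (intro tendsto_intros falling_ratio_tendsto_0) auto
  then have "eventually (\<lambda>M. (\<Sum>k<N. \<bar>falling M k / falling M N\<bar> * C k) < 1) sequentially"
    by (intro order_tendstoD(2)) auto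
  then show ?thesis using eventually_ge_at_top[of N]
  proof eventually_elim
    case (elim M)
    show ?case
    proof
      fix y assume y: "y \<in> X"
      have xy: "y - x \<noteq> 0" using y assms(2) by auto
      have M: "falling M N > 0" using elim(2) by (rule falling_pos)
      \<comment> \<open>\<open>S\<close> is the sum of the terms \<open>k < N\<close> relative to
        the term \<open>k = N\<close>. Its absolute value is less than 1, so no cancellation to 0
        can occur.\<close>
      define S where "S = (\<Sum>k<N. falling M k / falling M N * (poly (Q k * [:- x, 1:] ^ (N - k)) y / poly (Q N) y))"
      have "\<bar>S\<bar> \<le> (\<Sum>k<N. \<bar>falling M k / falling M N * (poly (Q k * [:- x, 1:] ^ (N - k)) y / poly (Q N) y)\<bar>)"
        unfolding S_def by (rule sum_abs)
      also have "\<dots> \<le> (\<Sum>k<N. \<bar>falling M k / falling M N\<bar> * C k)"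
        unfolding abs_mult[of "falling M _ / _"] using C y by (intro sum_mono mult_left_mono) auto
      finally have "1 + S \<noteq> 0" using elim(1) by linarith
      have "poly (T ([:- x, 1:] ^ M)) y =
          (\<Sum>k<N. falling M k * poly (Q k) y * (y - x) ^ (M - k)) + falling M N * poly (Q N) y * (y - x) ^ (M - N)"
        unfolding poly_T_linear_power by (simp add: lessThan_Suc_atMost [symmetric])
      also have "(\<Sum>k<N. falling M k * poly (Q k) y * (y - x) ^ (M - k)) =
          falling M N * poly (Q N) y * (y - x) ^ (M - N) * S"
        unfolding S_def sum_distrib_left
      proof (rule sum.cong)
        fix k assume "k \<in> {..<N}"
        then have "(y - x) ^ (M - k) = (y - x) ^ (M - N) * (y - x) ^ (N - k)"
          using elim(2) by (simp flip: power_add)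
        then show "falling M k * poly (Q k) y * (y - x) ^ (M - k) =
            falling M N * poly (Q N) y * (y - x) ^ (M - N) *
            (falling M k / falling M N * (poly (Q k * [:- x, 1:] ^ (N - k)) y / poly (Q N) y))"
          using M QNX[OF y] by simp
      qed simp
      also have "\<dots> + falling M N * poly (Q N) y * (y - x) ^ (M - N) =
          falling M N * poly (Q N) y * (y - x) ^ (M - N) * (1 + S)"
        by (simp add: algebra_simps)
      finally show "poly (T ([:- x, 1:] ^ M)) y \<noteq> 0"
        using \<open>1 + S \<noteq> 0\<close> M QNX[OF y] xy by simp
    qed
  qed
qed

text \<open>A zero \<open>\<zeta>\<close> below \<open>x\<close> would yield zeros in
  \<open>{..\<zeta>}\<close> for all larger exponents. But this closed half-line misses
  \<open>x\<close> and the zeros of \<open>Q N\<close>, so for large exponents it contains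
  none.\<close>

lemma T_linear_power_zeros_ge:
  assumes "T ([:- x, 1:] ^ n) \<noteq> 0" "\<And>y. y < x \<Longrightarrow> poly (Q N) y \<noteq> 0"
    and \<zeta>: "poly (T ([:- x, 1:] ^ n)) \<zeta> = 0"
  shows "x \<le> \<zeta>"
proof (rule ccontr)
  assume "\<not> x \<le> \<zeta>"
  then have "eventually (\<lambda>M. \<forall>y\<in>{..\<zeta>}. poly (T ([:- x, 1:] ^ M)) y \<noteq> 0) sequentially"
    using assms(2) by (intro T_linear_power_eventually_nonzero) auto
  then obtain M where "M \<ge> n" "\<forall>y\<in>{..\<zeta>}. poly (T ([:- x, 1:] ^ M)) y \<noteq> 0"
    using eventually_happens[OF eventually_conj[OF _ eventually_ge_at_top[of n]]] by fastforce
  then show False using T_linear_power_zeros_between[OF assms(1) \<zeta>] by fastforce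
qed

lemma T_linear_power_zeros_le:
  assumes "T ([:- x, 1:] ^ n) \<noteq> 0" "\<And>y. y > x \<Longrightarrow> poly (Q N) y \<noteq> 0"
    and \<zeta>: "poly (T ([:- x, 1:] ^ n)) \<zeta> = 0"
  shows "\<zeta> \<le> x"
proof (rule ccontr)
  assume "\<not> \<zeta> \<le> x"
  then have "eventually (\<lambda>M. \<forall>y\<in>{\<zeta>..}. poly (T ([:- x, 1:] ^ M)) y \<noteq> 0) sequentially"
    using assms(2) by (intro T_linear_power_eventually_nonzero) auto
  then obtain M where "M \<ge> n" "\<forall>y\<in>{\<zeta>..}. poly (T ([:- x, 1:] ^ M)) y \<noteq> 0"
    using eventually_happens[OF eventually_conj[OF _ eventually_ge_at_top[of n]]] by fastforce
  then show False using T_linear_power_zeros_between[OF assms(1) \<zeta>] by fastforce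
qed

text \<open>Monotonicity of \<open>T\<close> with all \<open>n\<close> zeros moved together;
  positivity of \<open>zeros_upto\<close> detects the zero.\<close>

lemma T_linear_power_zero_mono:
  assumes "\<And>y. T ([:- y, 1:] ^ n) \<noteq> 0" "x \<le> x'" "poly (T ([:- x', 1:] ^ n)) \<zeta> = 0"
  shows "\<exists>y\<le>\<zeta>. poly (T ([:- x, 1:] ^ n)) y = 0"
proof -
  have "zeros_upto (T ([:- x', 1:] ^ n)) \<zeta> > 0"
    using zeros_upto_pos_iff[OF assms(1)] assms(3) by blast
  also have "zeros_upto (T ([:- x', 1:] ^ n)) \<zeta> \<le> zeros_upto (T ([:- x, 1:] ^ n)) \<zeta>"
    using zeros_upto_T_prod_antimono[of "{..<n}" "\<lambda>_. x" "\<lambda>_. x'" \<zeta>] assms(2) by simp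
  finally show ?thesis using zeros_upto_pos_iff[OF assms(1)] by blast
qed

text \<open>If \<open>n \<le> N\<close>, no zero of \<open>T ([:- x, 1:] ^ n)\<close> can cross \<open>x\<close> while \<open>x\<close> increases to \<open>a\<close>,
  because the value of this polynomial at \<open>x\<close> is \<open>n! Q n (x)\<close>.\<close>

lemma T_linear_power_zeros_ge_smallest:
  assumes nz: "\<And>y. T ([:- y, 1:] ^ n) \<noteq> 0"
    and a: "\<And>y. y < a \<Longrightarrow> poly (Q (min n N)) y \<noteq> 0"
    and \<zeta>: "poly (T ([:- a, 1:] ^ n)) \<zeta> = 0"
  shows "a \<le> \<zeta>"
proof (cases "n \<le> N")
  case False
  then show ?thesis
    using T_linear_power_zeros_ge[OF nz _ \<zeta>] a by (simp add: min_def)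
next
  case True
  define g where "g x = T ([:- x, 1:] ^ n)" for x
  \<comment> \<open>A supremum argument: \<open>X\<close> is nonempty, contains its supremum
    \<open>s\<close>, and \<open>s < a\<close> would permit a further step to the right.\<close>
  define X where "X = {x. x \<le> a \<and> (\<forall>y. poly (g x) y = 0 \<longrightarrow> x \<le> y)}"
  define s where "s = Sup X"
  have fin: "finite {y. poly (g x) y = 0}" for x
    using nz unfolding g_def by (rule poly_roots_finite)
  \<comment> \<open>\<open>Q N\<close> has no zeros to the left of \<open>b\<close>, so
    \<open>min a b\<close> belongs to \<open>X\<close>. The inserted 0 provides a minimum when
    \<open>Q N\<close> has no zeros at all.\<close>
  define b where "b = Min (insert 0 {y. poly (Q N) y = 0})"
  have "b \<le> y" if "poly (Q N) y = 0" for y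
    unfolding b_def using poly_roots_finite[OF QN] that by (intro Min_le) auto
  then have b: "poly (Q N) y \<noteq> 0" if "y < min a b" for y
    using that by force
  have "min a b \<le> y" if "poly (g (min a b)) y = 0" for y
    using T_linear_power_zeros_ge[OF nz b that[unfolded g_def]] .
  then have "min a b \<in> X" by (simp add: X_def)
  have bdd: "bdd_above X" by (auto simp: X_def bdd_above_def)
  have "s \<le> a"
    unfolding s_def using \<open>min a b \<in> X\<close> by (intro cSup_least) (blast, simp add: X_def)
  have "s \<in> X"
  proof -
    \<comment> \<open>A zero of \<open>g s\<close> to the left of \<open>s\<close> would, by
      monotonicity, give \<open>g x\<close> a zero to the left of \<open>x\<close> for some
      \<open>x \<in> X\<close> close to \<open>s\<close>.\<close>
    have "s \<le> y" if y: "poly (g s) y = 0" for y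
    proof (rule ccontr)
      assume "\<not> s \<le> y"
      then obtain x where x: "x \<in> X" "y < x"
        using less_cSupD[of X y] \<open>min a b \<in> X\<close> by (auto simp: s_def)
      then have "x \<le> s" using bdd by (simp add: s_def cSup_upper)
      then obtain y' where "y' \<le> y" "poly (g x) y' = 0"
        using T_linear_power_zero_mono[OF nz _ y[unfolded g_def]] unfolding g_def by blast
      then show False using x by (force simp: X_def)
    qed
    then show ?thesis using \<open>s \<le> a\<close> by (simp add: X_def)
  qed
  have "s = a"
  proof (rule ccontr)
    assume "s \<noteq> a"
    then have "s < a" using \<open>s \<le> a\<close> by simp
    \<comment> \<open>For \<open>k > n\<close> the falling factorial vanishes, for
      \<open>k < n\<close> the power of \<open>s - s\<close>.\<close>
    have "poly (g s) s = (\<Sum>k\<in>{n}. falling n k * poly (Q k) s * (s - s) ^ (n - k))"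
      unfolding g_def poly_T_linear_power using True
      by (intro sum.mono_neutral_right) (auto simp: falling_eq_0 power_0_left)
    then have gs: "poly (g s) s \<noteq> 0"
      using a[OF \<open>s < a\<close>] True falling_pos[of n n] by (simp add: min_def)
    have less: "s < y" if "poly (g s) y = 0" for y
    proof -
      have "s \<le> y" using that \<open>s \<in> X\<close> by (simp add: X_def)
      moreover have "s \<noteq> y" using that gs by blast
      ultimately show ?thesis by simp
    qed
    \<comment> \<open>By monotonicity every zero of \<open>g t\<close> is at least some zero of
      \<open>g s\<close>, hence at least \<open>t\<close>; this puts \<open>t > s\<close> into
      \<open>X\<close>.\<close>
    define t where "t = Min (insert a {y. poly (g s) y = 0})"
    have "t \<in> insert a {y. poly (g s) y = 0}"
      unfolding t_def using fin by (intro Min_in) auto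
    then have "s < t" using less \<open>s < a\<close> by auto
    have t: "t \<le> a" "\<And>y. poly (g s) y = 0 \<Longrightarrow> t \<le> y"
      unfolding t_def using fin by (auto intro: Min_le)
    have "t \<le> y" if y: "poly (g t) y = 0" for y
      using T_linear_power_zero_mono[OF nz _ y[unfolded g_def], of s] \<open>s < t\<close> t(2)
      unfolding g_def by force
    then have "t \<in> X" using t(1) by (simp add: X_def)
    then have "t \<le> s" using bdd by (simp add: s_def cSup_upper)
    with \<open>s < t\<close> show False by simp
  qed
  then show ?thesis using \<open>s \<in> X\<close> \<zeta> by (simp add: X_def g_def)
qed

end

section \<open>Coefficientwise limits and zero patterns\<close>

lemma coeff_prod_tendsto:
  fixes p :: "nat \<Rightarrow> 'a \<Rightarrow> real poly"
  assumes "\<And>j k. j \<in> I \<Longrightarrow> (\<lambda>i. coeff (p i j) k) \<longlonglongrightarrow> coeff (q j) k"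
  shows "(\<lambda>i. coeff (\<Prod>j\<in>I. p i j) k) \<longlonglongrightarrow> coeff (\<Prod>j\<in>I. q j) k"
  using assms
proof (induction I arbitrary: k rule: infinite_finite_induct)
  case (insert j I)
  then show ?case by (simp add: coeff_mult) (intro tendsto_intros insert; simp)
qed auto

lemma poly_tendsto_prod_linear:
  assumes "\<And>j. j \<in> I \<Longrightarrow> (\<lambda>i. \<phi> i j) \<longlonglongrightarrow> \<psi> j"
  shows "poly_tendsto (\<lambda>i. \<Prod>j\<in>I. [:- \<phi> i j, 1:]) (\<Prod>j\<in>I. [:- \<psi> j, 1:])"
  unfolding poly_tendsto_def
  by (intro allI coeff_prod_tendsto)
     (auto simp: coeff_pCons split: nat.splits intro!: tendsto_intros assms)

lemma poly_tendsto_mult: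
  "poly_tendsto p p' \<Longrightarrow> poly_tendsto q q' \<Longrightarrow> poly_tendsto (\<lambda>i. p i * q i) (p' * q')"
  unfolding poly_tendsto_def coeff_mult by (intro allI tendsto_intros) auto

lemma poly_tendsto_const: "poly_tendsto (\<lambda>_. p) p"
  by (simp add: poly_tendsto_def)

lemma poly_tendsto_smult: "poly_tendsto p q \<Longrightarrow> poly_tendsto (\<lambda>i. smult c (p i)) (smult c q)"
  unfolding poly_tendsto_def coeff_smult by (intro allI tendsto_intros) auto

lemma poly_tendsto_diff_op:
  assumes "poly_tendsto p q"
  shows "poly_tendsto (\<lambda>i. diff_op N Q (p i)) (diff_op N Q q)"
proof -
  have "poly_tendsto (\<lambda>i. (pderiv ^^ k) (p i)) ((pderiv ^^ k) q)" for k
    using assms unfolding poly_tendsto_def coeff_higher_pderiv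
    by (intro allI tendsto_mult tendsto_const) auto
  then have "poly_tendsto (\<lambda>i. Q k * (pderiv ^^ k) (p i)) (Q k * (pderiv ^^ k) q)" for k
    by (intro poly_tendsto_mult poly_tendsto_const)
  then show ?thesis
    unfolding poly_tendsto_def diff_op_def coeff_sum by (intro allI tendsto_sum) auto
qed

lemma poly_tendsto_unique: "poly_tendsto p q \<Longrightarrow> poly_tendsto p q' \<Longrightarrow> q = q'"
  unfolding poly_tendsto_def by (intro poly_eqI) (blast intro: LIMSEQ_unique)

lemma poly_tendsto_Suc: "poly_tendsto (\<lambda>i. p (Suc i)) q \<Longrightarrow> poly_tendsto p q"
  unfolding poly_tendsto_def by (simp add: filterlim_sequentially_Suc[of "\<lambda>i. coeff (p i) _"])

text \<open>As \<open>g\<close> is nondecreasing, it lists the sorted zeros of the product, ties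
  included. This serves for the factorization of \<open>T (f i)\<close> and again for the limit,
  where distinct zeros may have merged.\<close>

lemma zero_pattern_prod_linear:
  assumes "c \<noteq> 0" "A \<inter> B = {}" "A \<union> B = {1..m}"
    and mono: "\<And>i j. 1 \<le> i \<Longrightarrow> i \<le> j \<Longrightarrow> j \<le> m \<Longrightarrow> g i \<le> g j"
  shows "zero_pattern (smult c (\<Prod>j\<in>A. [:- g j, 1:])) (\<Prod>j\<in>B. [:- g j, 1:]) A B"
proof -
  define v where "v = smult c (\<Prod>j\<in>A. [:- g j, 1:])"
  define f where "f = (\<Prod>j\<in>B. [:- g j, 1:])"
  have fin: "finite A" "finite B"
    using assms(3) by (metis finite_Un finite_atLeastAtMost)+
  have deg: "degree v = card A" "degree f = card B"
    using fin degree_prod_linear[of _ g] assms(1) by (simp_all add: v_def f_def)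
  have m: "card A + card B = m"
    using card_Un_disjoint[OF fin assms(2)] assms(3) by simp
  have vf: "v * f = smult c (\<Prod>j\<in>{1..m}. [:- g j, 1:])"
    unfolding v_def f_def assms(3) [symmetric] prod.union_disjoint[OF fin assms(2)] by simp
  have "proots (v * f) = image_mset g (mset_set {1..m})"
    unfolding vf using assms(1) proots_prod_linear[of "{1..m}" g] by simp
  then have sz: "sorted_zero (v * f) j = g j" if "j \<in> A \<union> B" for j
    using sorted_zero_of_sorted[of "v * f" g m j] mono that unfolding assms(3) by auto
  have "proots v = image_mset (sorted_zero (v * f)) (mset_set A)"
    using proots_prod_linear[OF fin(1), of g] assms(1) sz fin
    by (auto simp: v_def intro!: image_mset_cong)
  moreover have "proots f = image_mset (sorted_zero (v * f)) (mset_set B)"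
    using proots_prod_linear[OF fin(2), of g] sz fin
    by (auto simp: f_def intro!: image_mset_cong)
  moreover have "hyperbolic v" "hyperbolic f"
    using assms(1) by (auto simp: v_def f_def hyperbolic_smult_iff hyperbolic_prod_linear)
  ultimately show ?thesis
    using assms(2,3) deg m unfolding zero_pattern_def v_def [symmetric] f_def [symmetric]
    by (simp add: add.commute)
qed

lemma prod_linear_of_proots:
  assumes "hyperbolic p" "proots p = image_mset g (mset_set I)"
  shows "p = smult (lead_coeff p) (\<Prod>j\<in>I. [:- g j, 1:])"
  using hyperbolic_factorization[OF assms(1)] unfolding assms(2)
  by (simp add: image_mset.compositionality o_def prod_unfold_prod_mset)

text \<open>Evaluates the definite description. Uniqueness holds because the pattern determines both
  multisets of zeros, and monicity of the second factor fixes the scalar of the first.\<close>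

lemma pattern_factorization_eq:
  assumes h: "hyperbolic h" and AB: "A \<inter> B = {}" "A \<union> B = {1..degree h}"
  shows "pattern_factorization A B h =
    (smult (lead_coeff h) (\<Prod>j\<in>A. [:- sorted_zero h j, 1:]), \<Prod>j\<in>B. [:- sorted_zero h j, 1:])"
  (is "_ = (?v, ?f)")
  unfolding pattern_factorization_def
proof (rule the_equality)
  have fin: "finite A" "finite B"
    using AB(2) by (metis finite_Un finite_atLeastAtMost)+
  have size: "size (proots h) = degree h" using h by (rule hyperbolic_size_proots)
  have "h = smult (lead_coeff h) (\<Prod>j\<in>{1..degree h}. [:- sorted_zero h j, 1:])"
    using image_sorted_zero[of h] size by (intro prod_linear_of_proots[OF h]) simp
  also have "\<dots> = ?v * ?f"
    unfolding AB(2) [symmetric] prod.union_disjoint[OF fin AB(1)] by simp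
  finally have "h = ?v * ?f" .
  moreover have "zero_pattern ?v ?f A B"
    using AB hyperbolic_nonzero[OF h] sorted_zero_mono[of _ _ h] size
    by (intro zero_pattern_prod_linear) auto
  ultimately show "h = fst (?v, ?f) * snd (?v, ?f) \<and> lead_coeff (snd (?v, ?f)) = 1 \<and>
      zero_pattern (fst (?v, ?f)) (snd (?v, ?f)) A B"
    using lead_coeff_prod_linear[of "sorted_zero h" B] by (simp only: fst_conv snd_conv)
next
  fix vf assume vf: "h = fst vf * snd vf \<and> lead_coeff (snd vf) = 1 \<and> zero_pattern (fst vf) (snd vf) A B"
  obtain v f where "vf = (v, f)" by fastforce
  with vf have hvf: "h = v * f" "lead_coeff f = 1" "zero_pattern v f A B" by simp_all
  then have "hyperbolic f" "proots f = image_mset (sorted_zero h) (mset_set B)"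
    "hyperbolic v" "proots v = image_mset (sorted_zero h) (mset_set A)"
    by (simp_all add: zero_pattern_def)
  note prod_linear_of_proots[OF this(1,2)] prod_linear_of_proots[OF this(3,4)]
  moreover have "lead_coeff h = lead_coeff v" using hvf(1,2) by (simp add: lead_coeff_mult)
  ultimately show "vf = (?v, ?f)" using hvf(2) \<open>vf = (v, f)\<close> by simp
qed

theorem theorem1p5:
  fixes Q :: "nat \<Rightarrow> real poly" and N n r :: nat
    and T :: "real poly \<Rightarrow> real poly"
    and A B :: "nat set" and a :: real
    and f v :: "nat \<Rightarrow> real poly"
  assumes "Q N \<noteq> 0"
    and "T = diff_op N Q"
    and "preserves_hyperbolicity T"
    and "nondegenerate N Q"
    and "fuchs_index N Q = int r"
    and "T (monom 1 n) \<noteq> 0"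
    and "A \<subseteq> {1..n + r}" and "card A = r"
    and "B = {1..n + r} - A"
    and "(\<exists>x. poly (Q (min n N)) x = 0) \<longrightarrow> is_smallest_zero (Q (min n N)) a"
    and "f 0 = [:- a, 1:] ^ n"
    and "\<And>i. (v (Suc i), f (Suc i)) = pattern_factorization A B (T (f i))"
  shows "\<exists>f_lim v_lim. poly_tendsto f f_lim \<and> poly_tendsto v v_lim \<and>
           T f_lim = v_lim * f_lim \<and> zero_pattern v_lim f_lim A B"
proof -

  \<comment> \<open>The map on zeros induced by \<open>T\<close>\<close>
  note T = assms(2)
  have degQ: "degree (Q k) \<le> k + r" if "k \<le> N" for k
  proof (cases "Q k = 0")
    case False
    then have "int (degree (Q k)) - int k \<le> fuchs_index N Q"
      unfolding fuchs_index_def using that by (intro Max_ge) auto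
    then show ?thesis using assms(5) by linarith
  qed simp
  interpret P: hyperbolicity_preserver N r Q
    using assms(1,3,4,5) degQ unfolding T by unfold_locales (auto simp: nondegenerate_def)
  define m where "m = n + r"
  have AB: "A \<inter> B = {}" "A \<union> B = {1..m}" using assms(7,9) by (auto simp: m_def)
  have fin: "finite A" "finite B" using AB by (metis finite_Un finite_atLeastAtMost)+
  have cardB: "card B = n"
    using card_Un_disjoint[OF fin AB(1)] AB(2) assms(8) by (simp add: m_def)
  have "hyperbolic (monom 1 n)"
    using hyperbolic_power[OF hyperbolic_linear[of 0], of n] by (simp add: monom_altdef)
  \<comment> \<open>One nonzero image in degree \<open>n\<close> makes \<open>lam n\<close> nonzero,
    so every hyperbolic polynomial of degree \<open>n\<close> has an image of degree exactly
    \<open>m\<close>.\<close>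
  then have lam: "P.lam n \<noteq> 0"
    using P.lam_nonzero[of "monom 1 n" n] assms(6) by (simp add: T degree_monom_eq)
  define F where "F \<phi> = (\<Prod>j\<in>B. [:- \<phi> j, 1:])" for \<phi> :: "nat \<Rightarrow> real"
  have F: "degree (F \<phi>) = n" "lead_coeff (F \<phi>) = 1" "hyperbolic (F \<phi>)" "F \<phi> \<noteq> 0" for \<phi>
    using fin(2) degree_prod_linear[of B \<phi>] lead_coeff_prod_linear[of \<phi> B] hyperbolic_prod_linear[of \<phi> B]
    by (auto simp: F_def cardB)
  have TF: "degree (T (F \<phi>)) = m" "lead_coeff (T (F \<phi>)) = P.lam n" "T (F \<phi>) \<noteq> 0" for \<phi>
    using P.degree_T[of "F \<phi>"] F[of \<phi>] lam by (auto simp: T m_def)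
  have hypTF: "hyperbolic (T (F \<phi>))" for \<phi>
    using P.hyperbolic_T[OF F(3)] TF(3) unfolding T by blast
  have size: "size (proots (T (F \<phi>))) = m" for \<phi>
    using hyperbolic_size_proots[OF hypTF] TF(1) by simp
  \<comment> \<open>\<open>Z\<close> reads \<open>\<phi>\<close> only on \<open>B\<close> but
    returns all \<open>m\<close> sorted zeros: those with index in \<open>B\<close> feed the next
    step, those with index in \<open>A\<close> are the zeros of \<open>v\<close>.\<close>
  define Z where "Z \<phi> j = sorted_zero (T (F \<phi>)) j" for \<phi> j
  have Z_sorted: "Z \<phi> i \<le> Z \<phi> j" if "1 \<le> i" "i \<le> j" "j \<le> m" for \<phi> i j
    unfolding Z_def using that size by (intro sorted_zero_mono) auto
  have Z_root: "poly (T (F \<phi>)) (Z \<phi> j) = 0" if "j \<in> {1..m}" for \<phi> j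
    unfolding Z_def using that size by (intro sorted_zero_root) auto
  have Z_mono: "Z \<phi> j \<le> Z \<psi> j" if "\<And>j. j \<in> B \<Longrightarrow> \<phi> j \<le> \<psi> j" "j \<in> {1..m}" for \<phi> \<psi> j
    unfolding Z_def
  proof (rule sorted_zero_mono_of_zeros_upto)
    show "zeros_upto (T (F \<psi>)) x \<le> zeros_upto (T (F \<phi>)) x" for x
      unfolding F_def T using fin(2) that(1) by (rule P.zeros_upto_T_prod_antimono)
  qed (use that(2) size in auto)
  have F_const: "F (\<lambda>_. x) = [:- x, 1:] ^ n" for x by (simp add: F_def cardB)
  have nz: "P.T ([:- x, 1:] ^ n) \<noteq> 0" for x
    using TF(3)[of "\<lambda>_. x"] unfolding F_const T .

  \<comment> \<open>The iteration in terms of sorted zeros\<close>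
  define \<gamma> where "\<gamma> i = (Z ^^ i) (\<lambda>_. a)" for i
  have \<gamma>_Suc: "\<gamma> (Suc i) = Z (\<gamma> i)" for i by (simp add: \<gamma>_def)
  have step: "v (Suc i) = smult (P.lam n) (\<Prod>j\<in>A. [:- \<gamma> (Suc i) j, 1:]) \<and> f (Suc i) = F (\<gamma> (Suc i))"
    if "f i = F (\<gamma> i)" for i
    using assms(12)[of i] pattern_factorization_eq[OF hypTF[of "\<gamma> i"], of A B] AB TF
    by (simp add: that \<gamma>_Suc Z_def F_def)
  have f: "f i = F (\<gamma> i)" for i
  proof (induction i)
    case 0
    then show ?case using assms(11) by (simp add: \<gamma>_def F_const)
  qed (use step in blast)
  have v: "v (Suc i) = smult (P.lam n) (\<Prod>j\<in>A. [:- \<gamma> (Suc i) j, 1:])" for i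
    using step[OF f] by blast
  have Tf: "T (f i) = v (Suc i) * f (Suc i)" for i
  proof -
    have "T (f i) = smult (P.lam n) (\<Prod>j\<in>{1..m}. [:- \<gamma> (Suc i) j, 1:])"
      using prod_linear_of_proots[OF hypTF, OF image_sorted_zero [symmetric], of "\<gamma> i"]
      by (simp only: f \<gamma>_Suc Z_def size TF(2))
    also have "\<dots> = v (Suc i) * f (Suc i)"
      unfolding v f F_def AB(2) [symmetric] prod.union_disjoint[OF fin AB(1)] by simp
    finally show ?thesis .
  qed

  \<comment> \<open>Monotonicity and boundedness of the zeros\<close>
  have a: "poly (Q (min n N)) y \<noteq> 0" if "y < a" for y
    using assms(10) that by (force simp: is_smallest_zero_def)
  \<comment> \<open>This starts the monotone iteration and is where the choice of \<open>a\<close>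
    enters. If \<open>Q (min n N)\<close> has no zeros, the preceding condition holds for every real
    \<open>a\<close>.\<close>
  have first: "a \<le> \<gamma> 1 j" if "j \<in> {1..m}" for j
    using P.T_linear_power_zeros_ge_smallest[OF nz a] Z_root[OF that, of "\<lambda>_. a"]
    by (simp add: \<gamma>_def F_const T)
  have incr: "\<gamma> i j \<le> \<gamma> (Suc i) j" if "j \<in> {1..m}" for i j
    using that
  proof (induction i arbitrary: j)
    case 0
    then show ?case using first by (simp add: \<gamma>_def)
  next
    case (Suc i)
    have "\<gamma> i j \<le> \<gamma> (Suc i) j" if "j \<in> B" for j
      using Suc.IH AB(2) that by blast
    from Z_mono[OF this Suc.prems] show ?case by (simp only: \<gamma>_Suc)
  qed
  \<comment> \<open>\<open>b\<close> dominates the starting zeros and all zeros of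
    \<open>Q N\<close>. Hence no zero of \<open>T ([:- b, 1:] ^ n)\<close> exceeds \<open>b\<close>,
    and \<open>Z\<close> preserves the bound \<open>b\<close>.\<close>
  define b where "b = Max (insert a {y. poly (Q N) y = 0})"
  have b: "y \<le> b" if "y \<in> insert a {y. poly (Q N) y = 0}" for y
    unfolding b_def using poly_roots_finite[OF assms(1)] that by (intro Max_ge) auto
  have bound: "\<gamma> i j \<le> b" if "j \<in> {1..m}" for i j
    using that
  proof (induction i arbitrary: j)
    case 0
    then show ?case using b by (simp add: \<gamma>_def)
  next
    case (Suc i)
    have "\<gamma> i j \<le> b" if "j \<in> B" for j
      using Suc.IH AB(2) that by blast
    then have "Z (\<gamma> i) j \<le> Z (\<lambda>_. b) j"
      using Suc.prems by (rule Z_mono)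
    also have "\<dots> \<le> b"
      using P.T_linear_power_zeros_le[OF nz _ Z_root[OF Suc.prems, of "\<lambda>_. b", unfolded F_const T]] b
      by force
    finally show ?case by (simp add: \<gamma>_Suc)
  qed
  have "\<exists>l. (\<lambda>i. \<gamma> i j) \<longlonglongrightarrow> l" if "j \<in> {1..m}" for j
    using incseq_convergent[of "\<lambda>i. \<gamma> i j" b] incr[OF that] bound[OF that]
    by (metis incseq_SucI)
  then obtain \<gamma>' where \<gamma>': "\<And>j. j \<in> {1..m} \<Longrightarrow> (\<lambda>i. \<gamma> i j) \<longlonglongrightarrow> \<gamma>' j"
    by metis
  have \<gamma>'_sorted: "\<gamma>' i \<le> \<gamma>' j" if "1 \<le> i" "i \<le> j" "j \<le> m" for i j
  proof (rule LIMSEQ_le)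
    \<comment> \<open>The index is shifted because \<open>\<gamma> (Suc k)\<close> is a value of
      \<open>Z\<close> and therefore sorted.\<close>
    show "(\<lambda>k. \<gamma> (Suc k) i) \<longlonglongrightarrow> \<gamma>' i" "(\<lambda>k. \<gamma> (Suc k) j) \<longlonglongrightarrow> \<gamma>' j"
      using \<gamma>' that by (auto intro!: LIMSEQ_Suc)
    show "\<exists>k0. \<forall>k\<ge>k0. \<gamma> (Suc k) i \<le> \<gamma> (Suc k) j"
      unfolding \<gamma>_Suc using Z_sorted that by blast
  qed

  \<comment> \<open>Passage to the limit\<close>
  define f_lim where "f_lim = F \<gamma>'"
  define v_lim where "v_lim = smult (P.lam n) (\<Prod>j\<in>A. [:- \<gamma>' j, 1:])"
  have f_lim: "poly_tendsto f f_lim"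
    unfolding f f_lim_def F_def using \<gamma>' AB(2)
    by (intro poly_tendsto_prod_linear) blast
  \<comment> \<open>The recursion determines \<open>v\<close> only from index 1 on, so convergence
    is shown for the shifted sequence first.\<close>
  have v_lim: "poly_tendsto (\<lambda>i. v (Suc i)) v_lim"
    unfolding v v_lim_def using \<gamma>' AB(2)
    by (intro poly_tendsto_smult poly_tendsto_prod_linear LIMSEQ_Suc) blast
  have "poly_tendsto (\<lambda>i. T (f i)) (v_lim * f_lim)"
    unfolding Tf using f_lim v_lim
    by (intro poly_tendsto_mult) (auto simp: poly_tendsto_def intro: LIMSEQ_Suc)
  moreover have "poly_tendsto (\<lambda>i. T (f i)) (T f_lim)"
    unfolding T by (rule poly_tendsto_diff_op[OF f_lim])
  ultimately have "T f_lim = v_lim * f_lim"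
    by (intro poly_tendsto_unique)
  moreover have "zero_pattern v_lim f_lim A B"
    unfolding v_lim_def f_lim_def F_def
    using lam AB \<gamma>'_sorted by (intro zero_pattern_prod_linear) auto
  ultimately show ?thesis using f_lim poly_tendsto_Suc[OF v_lim] by blast
qed

end
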